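(* The randomized prompt mechanism HonestPerturbedGreedy (defined in the context) is truthful for myopic agents and is $\frac{e}{e-1}$-competitive in expectation: on every instance, with truthful reports, $\mathrm{OPT}\le \frac{e}{e-1}\cdot\mathbb{E}[\mathrm{SW}(\mu)]$, where $\mu$ is the random matching it produces and $\mathrm{OPT}$ is the welfare of the best offline matching. The factor is tight even for (not necessarily truthful) randomized online algorithms: no randomized online algorithm is $\alpha$-competitive for any $\alpha<\frac{e}{e-1}$.
   Context: Model. There is a bipartite graph $G=(B,I;E)$ with a set $B$ of $n$ buyers, known in advance, and a set $I$ of $m$ items arriving one by one in an unknown, possibly adversarial order (item $j$ arrives at time $j$). Buyer $i$ is interested in the items $j$ with $(i,j)\in E$, and has a value $v_i\ge 0$ for obtaining at least one item she is interested in (value $0$ otherwise). The edges and values are private information of the buyers. When item $j$ arrives, every buyer $i$ declares whether she is interested in it and, if so, a value; $b_{i,j}$ denotes her bid, with $b_{i,j}=0$ if not interested. All nonzero bids of a buyer must be equal to one value $b_i$. An online mechanism (or algorithm), possibly randomized, decides immediately and irrevocably, using only the bids on items up to $j$, either to assign $j$ to a buyer who declared interest in it and has not been assigned an item yet, or to leave $j$ unassigned forever. The result is a matching $\mu$ ($\mu_j$ is the buyer receiving $j$; $\mu^{-1}_i$ is the item received by $i$, $\emptyset$ if none). The mechanism also charges non-negative payments $p_i$; it is prompt if $p_i$ is determined at the moment buyer $i$ is assigned an item. Welfare. $\mathrm{SW}(\mu)=\sum_{i\in B} v_i\cdot \mathbb{I}[(i,\mu^{-1}_i)\in E]$, and $\mathrm{OPT}=\mathrm{SW}(\mu^\star)$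 where $\mu^\star$ is a maximum weight matching in $G$. A mechanism/algorithm is $\alpha$-competitive ($\alpha\ge 1$) if $\mathrm{OPT}\le\alpha\cdot \mathbb{E}[\mathrm{SW}(\mu)]$ on every instance. For the tightness claim, a (non-truthful) algorithm is one that receives the true values and edges online. Myopic agents. Upon arrival of item $j$, a myopic buyer $i$ maximizes only the utility of that round, $u_{i,j}=v_i\cdot\mathbb{I}[\mu_j=i,\ (i,j)\in E]-p_i$ (where $p_i$ is what she is charged in this round). A mechanism is truthful for myopic agents if (for every realization of the mechanism's randomness) in each round it is always in the best interest of a myopic buyer to declare truthfully. Mechanisms are required to be ex-post individually rational (utilities of truthful agents are non-negative for every realization). HonestPerturbedGreedy. Before the online phase, for each buyer $i$ draw independently $x_i$ uniformly from $[0,1]$, let $y_i=1-e^{x_i-1}$, and publicly reveal all $x_i,y_i$. When item $j$ arrives, receive the bids and let $N(j)$ be the set of not-yet-discarded buyers declaring interest in $j$. If $N(j)=\emptyset$, discard $j$. Otherwise allocate $j$ to $i^\star\in\arg\max\{b_i y_i: i\in N(j)\}$, charge $i^\star$ the price $p_{i^\star}=\max\{\frac{y_i}{y_{i^\star}}b_i : i\in N(j)\setminus\{i^\star\}\}$ (the maximum over the empty set being $0$), and discard $i^\star$ from further consideration. *)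

theory Defs
  imports "HOL-Probability.Probability"
begin

section \<open>Markets, matchings and welfare\<close>

text \<open>Buyers are labelled by natural numbers. Items are \<open>0, ..., n_items - 1\<close> in order of
  arrival, so quantifying over all edge sets covers every arrival order.\<close>

record market =
  buyers :: "nat set"
  n_items :: nat
  edges :: "(nat \<times> nat) set"
  val :: "nat \<Rightarrow> real"

definition wf_market :: "market \<Rightarrow> bool" where
  "wf_market G \<longleftrightarrow> finite (buyers G) \<and> edges G \<subseteq> buyers G \<times> {..<n_items G} \<and>
     (\<forall>i\<in>buyers G. 0 \<le> val G i)"

text \<open>An assignment \<open>\<mu>\<close> maps each item to the buyer receiving it, if any.\<close>

definition is_matching :: "market \<Rightarrow> (nat \<Rightarrow> nat option) \<Rightarrow> bool" where
  "is_matching G \<mu> \<longleftrightarrow> (\<forall>i j. \<mu> j = Some i \<longrightarrow> (i, j) \<in> edges G) \<and>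
     (\<forall>i j k. \<mu> j = Some i \<and> \<mu> k = Some i \<longrightarrow> j = k)"

definition satisfied :: "market \<Rightarrow> (nat \<Rightarrow> nat option) \<Rightarrow> nat \<Rightarrow> bool" where
  "satisfied G \<mu> i \<longleftrightarrow> (\<exists>j. \<mu> j = Some i \<and> (i, j) \<in> edges G)"

definition SW :: "market \<Rightarrow> (nat \<Rightarrow> nat option) \<Rightarrow> real" where
  "SW G \<mu> = (\<Sum>i\<in>buyers G. val G i * of_bool (satisfied G \<mu> i))"

definition OPT :: "market \<Rightarrow> real" where
  "OPT G = Max (SW G ` {\<mu>. is_matching G \<mu>})"

lemma finite_matchings:
  assumes "wf_market G"
  shows "finite {\<mu>. is_matching G \<mu>}"
proof (rule finite_subset)
  let ?F = "{\<mu>. \<forall>j. (j \<in> {..<n_items G} \<longrightarrow> \<mu> j \<in> insert None (Some ` buyers G)) \<and>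
                   (j \<notin> {..<n_items G} \<longrightarrow> \<mu> j = None)}"
  show "finite ?F"
    using assms by (intro finite_set_of_finite_funs) (auto simp: wf_market_def)
  show "{\<mu>. is_matching G \<mu>} \<subseteq> ?F"
  proof (intro subsetI CollectI allI)
    fix \<mu> j
    assume "\<mu> \<in> {\<mu>. is_matching G \<mu>}"
    then have "i \<in> buyers G \<and> j < n_items G" if "\<mu> j = Some i" for i
      using assms that unfolding is_matching_def wf_market_def by blast
    then show "(j \<in> {..<n_items G} \<longrightarrow> \<mu> j \<in> insert None (Some ` buyers G)) \<and>
               (j \<notin> {..<n_items G} \<longrightarrow> \<mu> j = None)"
      by (cases "\<mu> j") auto
  qed
qed

lemma is_matching_empty: "is_matching G (\<lambda>_. None)"
  by (simp add: is_matching_def)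


section \<open>Declarations\<close>

text \<open>In one round a buyer declares either \<open>None\<close> (not interested in the current item) or
  \<open>Some b\<close> (interested, with value \<open>b\<close>).\<close>

type_synonym profile = "nat \<Rightarrow> real option"

definition bid :: "profile \<Rightarrow> nat \<Rightarrow> real" where
  "bid b i = (case b i of None \<Rightarrow> 0 | Some r \<Rightarrow> r)"

definition valid_bids :: "nat set \<Rightarrow> profile list \<Rightarrow> bool" where
  "valid_bids B bs \<longleftrightarrow>
     (\<forall>b\<in>set bs. \<forall>i. (i \<notin> B \<longrightarrow> b i = None) \<and> 0 \<le> bid b i) \<and>
     (\<forall>i. \<forall>b\<in>set bs. \<forall>b'\<in>set bs. bid b i \<noteq> 0 \<and> bid b' i \<noteq> 0 \<longrightarrow> bid b i = bid b' i)"

definition true_decl :: "market \<Rightarrow> nat \<Rightarrow> profile" where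
  "true_decl G j i = (if (i, j) \<in> edges G then Some (val G i) else None)"

definition truthful_bids :: "market \<Rightarrow> profile list" where
  "truthful_bids G = map (true_decl G) [0..<n_items G]"


section \<open>Online algorithms and mechanisms\<close>

text \<open>For a realization \<open>\<omega>\<close> of the randomness and a nonempty list \<open>bs\<close> of the profiles of all
  rounds so far, \<open>assign A \<omega> bs\<close> is the decision on the item of the last round in \<open>bs\<close>, and
  \<open>charge A \<omega> bs i\<close> is what buyer \<open>i\<close> is charged in that round.\<close>

record 'w algorithm =
  rand :: "'w measure"
  assign :: "'w \<Rightarrow> profile list \<Rightarrow> nat option"

record 'w mechanism = "'w algorithm" +
  charge :: "'w \<Rightarrow> profile list \<Rightarrow> nat \<Rightarrow> real"

definition outcome :: "('w, 'z) algorithm_scheme \<Rightarrow> 'w \<Rightarrow> profile list \<Rightarrow> nat \<Rightarrow> nat option" where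
  "outcome A \<omega> bs j = (if j < length bs then assign A \<omega> (take (Suc j) bs) else None)"

definition online_algorithm :: "nat set \<Rightarrow> ('w, 'z) algorithm_scheme \<Rightarrow> bool" where
  "online_algorithm B A \<longleftrightarrow> prob_space (rand A) \<and>
     (\<forall>bs. valid_bids B bs \<and> bs \<noteq> [] \<longrightarrow>
        (\<lambda>\<omega>. assign A \<omega> bs) \<in> measurable (rand A) (count_space UNIV) \<and>
        (\<forall>\<omega>\<in>space (rand A). \<forall>i. assign A \<omega> bs = Some i \<longrightarrow>
           i \<in> B \<and> last bs i \<noteq> None \<and>
           (\<forall>j < length bs - 1. outcome A \<omega> bs j \<noteq> Some i)))"

definition expected_welfare :: "('w, 'z) algorithm_scheme \<Rightarrow> market \<Rightarrow> real" where
  "expected_welfare A G =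
     integral\<^sup>L (rand A) (\<lambda>\<omega>. SW G (outcome A \<omega> (truthful_bids G)))"

text \<open>The set of buyers is known in advance, so what is competitive or not is a family of
  algorithms, one for every finite set of buyers. The number of items is not known.\<close>

definition competitive :: "real \<Rightarrow> (nat set \<Rightarrow> ('w, 'z) algorithm_scheme) \<Rightarrow> bool" where
  "competitive \<alpha> F \<longleftrightarrow> 1 \<le> \<alpha> \<and>
     (\<forall>G. wf_market G \<longrightarrow> OPT G \<le> \<alpha> * expected_welfare (F (buyers G)) G)"

definition payment :: "('w, 'z) mechanism_scheme \<Rightarrow> 'w \<Rightarrow> profile list \<Rightarrow> nat \<Rightarrow> real" where
  "payment A \<omega> bs i = (\<Sum>j<length bs. charge A \<omega> (take (Suc j) bs) i)"

definition online_mechanism :: "nat set \<Rightarrow> ('w, 'z) mechanism_scheme \<Rightarrow> bool" where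
  "online_mechanism B A \<longleftrightarrow> online_algorithm B A \<and>
     (\<forall>\<omega>\<in>space (rand A). \<forall>bs i. valid_bids B bs \<and> bs \<noteq> [] \<and> i \<in> B \<longrightarrow> 0 \<le> charge A \<omega> bs i)"

definition prompt :: "nat set \<Rightarrow> ('w, 'z) mechanism_scheme \<Rightarrow> bool" where
  "prompt B A \<longleftrightarrow>
     (\<forall>\<omega>\<in>space (rand A). \<forall>bs cs i. valid_bids B (bs @ cs) \<and> bs \<noteq> [] \<and>
        assign A \<omega> bs = Some i \<longrightarrow> payment A \<omega> (bs @ cs) i = payment A \<omega> bs i)"

definition ex_post_IR :: "nat set \<Rightarrow> ('w, 'z) mechanism_scheme \<Rightarrow> bool" where
  "ex_post_IR B A \<longleftrightarrow>
     (\<forall>G. wf_market G \<and> buyers G = B \<longrightarrow>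
       (\<forall>\<omega>\<in>space (rand A). \<forall>bs. \<forall>i\<in>B.
          valid_bids B bs \<and> length bs = n_items G \<and>
          (\<forall>j<n_items G. (bs ! j) i = true_decl G j i) \<longrightarrow>
          0 \<le> val G i * of_bool (satisfied G (outcome A \<omega> bs) i) - payment A \<omega> bs i))"

definition round_utility ::
    "market \<Rightarrow> ('w, 'z) mechanism_scheme \<Rightarrow> 'w \<Rightarrow> profile list \<Rightarrow> nat \<Rightarrow> real" where
  "round_utility G A \<omega> bs i =
     val G i * of_bool (assign A \<omega> bs = Some i \<and> (i, length bs - 1) \<in> edges G) - charge A \<omega> bs i"

text \<open>Below, \<open>h\<close> are the declarations of the earlier rounds, \<open>b\<close> those of the other buyers in the
  current round, and \<open>d\<close> is an alternative declaration of buyer \<open>i\<close>.\<close>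

definition truthful_myopic :: "nat set \<Rightarrow> ('w, 'z) mechanism_scheme \<Rightarrow> bool" where
  "truthful_myopic B A \<longleftrightarrow>
     (\<forall>G. wf_market G \<and> buyers G = B \<longrightarrow>
       (\<forall>\<omega>\<in>space (rand A). \<forall>h b d. \<forall>i\<in>B.
          let truth = h @ [b(i := true_decl G (length h) i)];
              lie = h @ [b(i := d)]
          in length h < n_items G \<and> valid_bids B truth \<and> valid_bids B lie \<longrightarrow>
             round_utility G A \<omega> lie i \<le> round_utility G A \<omega> truth i))"


section \<open>HonestPerturbedGreedy\<close>

text \<open>The perturbation is a vector \<open>x\<close> with coordinates in \<open>[0,1]\<close>. The set of maximizers of the
  perturbed bid may have several elements; \<open>tie\<close> selects one of them.\<close>

definition hpg_y :: "(nat \<Rightarrow> real) \<Rightarrow> nat \<Rightarrow> real" where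
  "hpg_y x i = 1 - exp (x i - 1)"

definition hpg_N :: "nat set \<Rightarrow> nat set \<Rightarrow> profile \<Rightarrow> nat set" where
  "hpg_N B D b = {i \<in> B - D. b i \<noteq> None}"

definition hpg_choice ::
    "(nat set \<Rightarrow> nat) \<Rightarrow> nat set \<Rightarrow> (nat \<Rightarrow> real) \<Rightarrow> nat set \<Rightarrow> profile \<Rightarrow> nat option" where
  "hpg_choice tie B x D b =
     (if hpg_N B D b = {} then None
      else Some (tie {i. is_arg_max (\<lambda>i. bid b i * hpg_y x i) (\<lambda>i. i \<in> hpg_N B D b) i}))"

definition hpg_discarded ::
    "(nat set \<Rightarrow> nat) \<Rightarrow> nat set \<Rightarrow> (nat \<Rightarrow> real) \<Rightarrow> profile list \<Rightarrow> nat set" where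
  "hpg_discarded tie B x bs = foldl (\<lambda>D b. D \<union> set_option (hpg_choice tie B x D b)) {} bs"

definition hpg_assign ::
    "(nat set \<Rightarrow> nat) \<Rightarrow> nat set \<Rightarrow> (nat \<Rightarrow> real) \<Rightarrow> profile list \<Rightarrow> nat option" where
  "hpg_assign tie B x bs =
     (if bs = [] then None
      else hpg_choice tie B x (hpg_discarded tie B x (butlast bs)) (last bs))"

text \<open>The quotient below has denominator \<open>0\<close> only if \<open>x i = 1\<close> for the winner \<open>i\<close>, an event of
  probability zero in which all perturbed bids vanish; the price is then \<open>0\<close>.\<close>

definition hpg_charge ::
    "(nat set \<Rightarrow> nat) \<Rightarrow> nat set \<Rightarrow> (nat \<Rightarrow> real) \<Rightarrow> profile list \<Rightarrow> nat \<Rightarrow> real" where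
  "hpg_charge tie B x bs i =
     (if hpg_assign tie B x bs = Some i then
        (let R = hpg_N B (hpg_discarded tie B x (butlast bs)) (last bs) - {i}
         in if R = {} then 0 else Max ((\<lambda>k. hpg_y x k / hpg_y x i * bid (last bs) k) ` R))
      else 0)"

text \<open>Lebesgue measure restricted to \<open>[0,1]\<close> is the uniform distribution; unlike
  \<^term>\<open>uniform_measure lborel {0..1::real}\<close>, its space consists only of points of \<open>[0,1]\<close>, so that
  ``every realization'' ranges over \<open>x\<close> with all coordinates in \<open>[0,1]\<close>.\<close>

definition hpg :: "(nat set \<Rightarrow> nat) \<Rightarrow> nat set \<Rightarrow> (nat \<Rightarrow> real) mechanism" where
  "hpg tie B =
     \<lparr> rand = (\<Pi>\<^sub>M i\<in>B. restrict_space lborel {0..1}),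
       assign = hpg_assign tie B,
       charge = hpg_charge tie B \<rparr>"

end

theory Submission
  imports Defs "HOL-Real_Asymp.Real_Asymp" "HOL-Combinatorics.Permutations"
begin

text \<open>A buyer served by HonestPerturbedGreedy pays a threshold that does not depend on her bid and
  is at most her bid, which gives the incentive properties.

  The upper bound is the randomized primal-dual argument of Devanur, Jain and Kleinberg. Split the
  value of every served buyer \<open>i\<close> into a share \<open>v\<^sub>i exp (x i - 1)\<close> for herself and
  \<open>v\<^sub>i y\<^sub>i\<close> for her item. Fix an edge \<open>(i, j)\<close> and all perturbations but \<open>x i\<close>, and let \<open>u\<close> be the
  share of \<open>j\<close> in the run without \<open>i\<close>. With \<open>i\<close> present the share of \<open>j\<close> is still at least \<open>u\<close>, and
  \<open>i\<close> is served whenever \<open>v\<^sub>i y\<^sub>i > u\<close>. Integrating over \<open>x i\<close>, the two shares sum to at least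
  \<open>(1 - 1/e) v\<^sub>i\<close> in expectation; summing over the edges of an optimal matching gives the bound.

  The lower bound averages over the relabellings of the upper triangular graph of Karp, Vazirani
  and Vazirani. By symmetry, item \<open>j\<close> goes to the last buyer with probability
  \<open>a\<^sub>j / (n - j)\<close>, where \<open>a\<^sub>j\<close> is the probability that it is assigned. So
  \<open>(\<Sum>j. a\<^sub>j / (n - j)) \<le> 1\<close>, and LP duality bounds \<open>\<Sum>j. a\<^sub>j\<close> by \<open>(1 - 1/e) n + o(n)\<close>.\<close>

section \<open>Incentives and measurability\<close>

text \<open>The distribution of the perturbations gets a name of its own because it is also needed
  over \<open>B - {i}\<close>, when the coordinate of a single buyer is integrated out.\<close>

definition cube :: "nat set \<Rightarrow> (nat \<Rightarrow> real) measure" where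
  "cube B = (\<Pi>\<^sub>M i\<in>B. restrict_space lborel {0..1})"

lemma rand_hpg: "rand (hpg tie B) = cube B"
  by (simp add: hpg_def cube_def)

lemma space_cube: "x \<in> space (cube B) \<Longrightarrow> k \<in> B \<Longrightarrow> x k \<in> {0..1}"
  by (auto simp: cube_def space_PiM space_restrict_space PiE_def Pi_def)

lemma prob_space_unit: "prob_space (restrict_space lborel {0..1::real})"
  by (rule prob_spaceI) (simp add: emeasure_restrict_space space_restrict_space)

lemma prob_space_cube: "prob_space (cube B)"
  unfolding cube_def using prob_space_unit by (auto intro: prob_space_PiM)

lemma measurable_coord_cube:
  assumes "k \<in> B"
  shows "(\<lambda>x. x k) \<in> borel_measurable (cube B)"
proof -
  have "(\<lambda>x. x k) \<in> measurable (cube B) (restrict_space lborel {0..1})"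
    using assms unfolding cube_def by (rule measurable_component_singleton)
  then show ?thesis by (simp add: measurable_restrict_space2_iff)
qed

lemma hpg_y_measurable:
  assumes "k \<in> B"
  shows "(\<lambda>x. hpg_y x k) \<in> borel_measurable (cube B)"
proof -
  note [measurable] = measurable_coord_cube[OF assms]
  show ?thesis unfolding hpg_y_def by measurable
qed

lemma hpg_y_nonneg: "x k \<in> {0..1} \<Longrightarrow> 0 \<le> hpg_y x k"
  by (simp add: hpg_y_def)

section \<open>The allocation rule and the set of discarded buyers\<close>

context
  fixes tie :: "nat set \<Rightarrow> nat" and B :: "nat set"
  assumes tie: "\<And>S. finite S \<Longrightarrow> S \<noteq> {} \<Longrightarrow> tie S \<in> S" and finB: "finite B"
begin

text \<open>These are the two conditions under which \<open>tie\<close> is known to select a member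
  of the set of maximizers.\<close>

lemma hpg_argmax_props:
  assumes "hpg_N B D b \<noteq> {}"
  shows "finite {i. is_arg_max (\<lambda>i. bid b i * hpg_y x i) (\<lambda>i. i \<in> hpg_N B D b) i}"
    and "{i. is_arg_max (\<lambda>i. bid b i * hpg_y x i) (\<lambda>i. i \<in> hpg_N B D b) i} \<noteq> {}"
proof -
  let ?f = "\<lambda>i. bid b i * hpg_y x i"
  have fin: "finite (hpg_N B D b)"
    using finB by (simp add: hpg_N_def)
  then show "finite {i. is_arg_max ?f (\<lambda>i. i \<in> hpg_N B D b) i}"
    by (rule rev_finite_subset) (auto simp: is_arg_max_def)
  have "Max (?f ` hpg_N B D b) \<in> ?f ` hpg_N B D b"
    using fin assms by (intro Max_in) auto
  then obtain i where i: "i \<in> hpg_N B D b" "?f i = Max (?f ` hpg_N B D b)" by auto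
  have "is_arg_max ?f (\<lambda>i. i \<in> hpg_N B D b) i"
    unfolding is_arg_max_def using i fin by (auto simp: not_less)
  then show "{i. is_arg_max ?f (\<lambda>i. i \<in> hpg_N B D b) i} \<noteq> {}" by blast
qed

lemma hpg_choice_SomeD:
  assumes "hpg_choice tie B x D b = Some i"
  shows "i \<in> hpg_N B D b" and "k \<in> hpg_N B D b \<Longrightarrow> bid b k * hpg_y x k \<le> bid b i * hpg_y x i"
proof -
  have ne: "hpg_N B D b \<noteq> {}"
    using assms by (auto simp: hpg_choice_def split: if_splits)
  have "i = tie {i. is_arg_max (\<lambda>i. bid b i * hpg_y x i) (\<lambda>i. i \<in> hpg_N B D b) i}"
    using assms ne by (simp add: hpg_choice_def)
  then have "is_arg_max (\<lambda>i. bid b i * hpg_y x i) (\<lambda>i. i \<in> hpg_N B D b) i"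
    using tie[OF hpg_argmax_props[OF ne]] by auto
  then show "i \<in> hpg_N B D b" "k \<in> hpg_N B D b \<Longrightarrow> bid b k * hpg_y x k \<le> bid b i * hpg_y x i"
    by (auto simp: is_arg_max_def not_less)
qed

lemma hpg_choice_None_iff: "hpg_choice tie B x D b = None \<longleftrightarrow> hpg_N B D b = {}"
  by (simp add: hpg_choice_def)

lemma hpg_discarded_snoc:
  "hpg_discarded tie B x (bs @ [b]) =
     hpg_discarded tie B x bs \<union> set_option (hpg_assign tie B x (bs @ [b]))"
  by (simp add: hpg_discarded_def hpg_assign_def)

text \<open>The fold is replaced by a description in terms of the single rounds, in which discarded
  buyers can be compared with the outcome of a run.\<close>

lemma hpg_discarded_eq:
  "hpg_discarded tie B x bs = {i. \<exists>j<length bs. hpg_assign tie B x (take (Suc j) bs) = Some i}"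
proof (induction bs rule: rev_induct)
  case Nil
  then show ?case by (simp add: hpg_discarded_def)
next
  case (snoc b bs)
  show ?case
    unfolding hpg_discarded_snoc snoc.IH by (auto simp: less_Suc_eq)
qed

lemma hpg_assign_SomeD:
  assumes "hpg_assign tie B x bs = Some i"
  shows "bs \<noteq> []" "i \<in> B" "last bs i \<noteq> None" "i \<notin> hpg_discarded tie B x (butlast bs)"
    and "i \<in> hpg_N B (hpg_discarded tie B x (butlast bs)) (last bs)"
    and "k \<in> hpg_N B (hpg_discarded tie B x (butlast bs)) (last bs) \<Longrightarrow>
      bid (last bs) k * hpg_y x k \<le> bid (last bs) i * hpg_y x i"
proof -
  show ne: "bs \<noteq> []" using assms by (auto simp: hpg_assign_def split: if_splits)
  then have c: "hpg_choice tie B x (hpg_discarded tie B x (butlast bs)) (last bs) = Some i"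
    using assms by (simp add: hpg_assign_def)
  from hpg_choice_SomeD[OF c]
  show "i \<in> B" "last bs i \<noteq> None" "i \<notin> hpg_discarded tie B x (butlast bs)"
    "i \<in> hpg_N B (hpg_discarded tie B x (butlast bs)) (last bs)"
    "k \<in> hpg_N B (hpg_discarded tie B x (butlast bs)) (last bs) \<Longrightarrow>
      bid (last bs) k * hpg_y x k \<le> bid (last bs) i * hpg_y x i"
    by (auto simp: hpg_N_def)
qed

text \<open>A winner enters the discarded set in the round in which she wins, and every later winner
  lies outside that set.\<close>

lemma hpg_assign_once:
  assumes "hpg_assign tie B x (take (Suc j) bs) = Some i"
    and "hpg_assign tie B x (take (Suc k) bs) = Some i" and "j < length bs" "k < length bs"
  shows "j = k"
proof -
  have False if "j < k" "k < length bs" "hpg_assign tie B x (take (Suc j) bs) = Some i"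
    "hpg_assign tie B x (take (Suc k) bs) = Some i" for j k
  proof -
    have "i \<in> hpg_discarded tie B x (butlast (take (Suc k) bs))"
      unfolding hpg_discarded_eq using that by (auto simp: butlast_take intro!: exI[of _ j])
    with hpg_assign_SomeD(4)[OF that(4)] show False by blast
  qed
  with assms show ?thesis by (metis linorder_neqE_nat)
qed

section \<open>Payments, promptness, individual rationality and truthfulness\<close>

lemma space_hpg: "\<omega> \<in> space (rand (hpg tie B)) \<Longrightarrow> k \<in> B \<Longrightarrow> \<omega> k \<in> {0..1}"
  using space_cube by (simp add: rand_hpg)

lemma hpg_charge_unassigned: "hpg_assign tie B x bs \<noteq> Some i \<Longrightarrow> hpg_charge tie B x bs i = 0"
  by (simp add: hpg_charge_def)

lemma hpg_charge_nonneg: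
  assumes x: "\<And>k. k \<in> B \<Longrightarrow> x k \<in> {0..1}" and nn: "\<And>k. 0 \<le> bid (last bs) k"
  shows "0 \<le> hpg_charge tie B x bs i"
proof (cases "hpg_assign tie B x bs = Some i")
  case True
  define R where "R = hpg_N B (hpg_discarded tie B x (butlast bs)) (last bs) - {i}"
  have R: "finite R" "R \<subseteq> B" using finB by (auto simp: R_def hpg_N_def)
  have "0 \<le> hpg_y x k / hpg_y x i * bid (last bs) k" if "k \<in> R" for k
    using hpg_assign_SomeD(2)[OF True] that R(2) nn x
    by (auto intro!: mult_nonneg_nonneg divide_nonneg_nonneg hpg_y_nonneg)
  then have "0 \<le> Max ((\<lambda>k. hpg_y x k / hpg_y x i * bid (last bs) k) ` R)" if "R \<noteq> {}"
    using that R(1) by (subst Max_ge_iff) auto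
  then show ?thesis using True unfolding hpg_charge_def Let_def R_def[symmetric] by simp
qed (simp add: hpg_charge_unassigned)

text \<open>The perturbed bid of the winner is maximal; dividing by her factor
  \<open>hpg_y x i\<close> turns this comparison into the bound on the price.\<close>

lemma hpg_charge_le_bid:
  assumes x: "\<And>k. k \<in> B \<Longrightarrow> x k \<in> {0..1}" and nn: "\<And>k. 0 \<le> bid (last bs) k"
    and a: "hpg_assign tie B x bs = Some i"
  shows "hpg_charge tie B x bs i \<le> bid (last bs) i"
proof -
  define R where "R = hpg_N B (hpg_discarded tie B x (butlast bs)) (last bs) - {i}"
  have R: "finite R" using finB by (auto simp: R_def hpg_N_def)
  have y: "0 \<le> hpg_y x i" using hpg_assign_SomeD(2)[OF a] x hpg_y_nonneg by blast
  have "hpg_y x k / hpg_y x i * bid (last bs) k \<le> bid (last bs) i" if "k \<in> R" for k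
  \<comment> \<open>If the factor of the winner vanishes, division by zero gives the quotient the
    value 0, which her nonnegative bid dominates.\<close>
  proof (cases "hpg_y x i = 0")
    case False
    then have "0 < hpg_y x i" using y by simp
    moreover have "bid (last bs) k * hpg_y x k \<le> bid (last bs) i * hpg_y x i"
      using hpg_assign_SomeD(6)[OF a] that by (simp add: R_def)
    ultimately show ?thesis by (simp add: divide_simps mult.commute)
  qed (use nn in simp)
  then have "Max ((\<lambda>k. hpg_y x k / hpg_y x i * bid (last bs) k) ` R) \<le> bid (last bs) i"
    if "R \<noteq> {}"
    using that R by (subst Max_le_iff) auto
  then show ?thesis using a nn unfolding hpg_charge_def Let_def R_def[symmetric] by simp
qed

text \<open>A buyer is charged only in a round that she wins, and she wins at most once, so all
  charges after that round are 0.\<close>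

lemma prompt_hpg: "prompt B (hpg tie B)"
  unfolding prompt_def
proof (intro ballI allI impI, elim conjE)
  fix \<omega> bs cs i
  assume ne: "bs \<noteq> []" and a: "assign (hpg tie B) \<omega> bs = Some i"
  have "charge (hpg tie B) \<omega> (take (Suc j) (bs @ cs)) i = 0"
    if j: "j \<in> {length bs..<length (bs @ cs)}" for j
  proof -
    have "hpg_assign tie B \<omega> (take (Suc j) (bs @ cs)) \<noteq> Some i"
    proof
      assume "hpg_assign tie B \<omega> (take (Suc j) (bs @ cs)) = Some i"
      moreover have "hpg_assign tie B \<omega> (take (Suc (length bs - 1)) (bs @ cs)) = Some i"
        using ne a by (simp add: hpg_def Suc_diff_le)
      ultimately have "j = length bs - 1"
        by (rule hpg_assign_once) (use j ne in auto)
      with j ne show False by (cases bs) auto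
    qed
    then show ?thesis by (simp add: hpg_def hpg_charge_unassigned)
  qed
  then have "(\<Sum>j\<in>{length bs..<length (bs @ cs)}. charge (hpg tie B) \<omega> (take (Suc j) (bs @ cs)) i) = 0"
    by (rule sum.neutral[OF ballI])
  moreover have "payment (hpg tie B) \<omega> (bs @ cs) i =
    (\<Sum>j<length bs. charge (hpg tie B) \<omega> (take (Suc j) (bs @ cs)) i) +
    (\<Sum>j\<in>{length bs..<length (bs @ cs)}. charge (hpg tie B) \<omega> (take (Suc j) (bs @ cs)) i)"
    unfolding payment_def
    by (subst sum.union_disjoint[symmetric]) (auto intro!: sum.cong)
  ultimately show "payment (hpg tie B) \<omega> (bs @ cs) i = payment (hpg tie B) \<omega> bs i"
    by (simp add: payment_def Suc_leI)
qed

text \<open>The whole payment is the charge of the one round that the buyer wins. In that round her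
  bid is her value, which she also obtains, and the charge does not exceed the bid.\<close>

lemma ex_post_IR_hpg: "ex_post_IR B (hpg tie B)"
  unfolding ex_post_IR_def
proof (intro ballI allI impI, elim conjE)
  fix G \<omega> bs i
  assume wf: "wf_market G" and G: "buyers G = B" and \<omega>: "\<omega> \<in> space (rand (hpg tie B))"
    and i: "i \<in> B" and vb: "valid_bids B bs" and len: "length bs = n_items G"
    and truth: "\<forall>j<n_items G. (bs ! j) i = true_decl G j i"
  have v: "0 \<le> val G i" using wf i G by (auto simp: wf_market_def)
  have pay: "payment (hpg tie B) \<omega> bs i = (\<Sum>j<length bs. hpg_charge tie B \<omega> (take (Suc j) bs) i)"
    by (simp add: payment_def hpg_def)
  show "0 \<le> val G i * of_bool (satisfied G (outcome (hpg tie B) \<omega> bs) i)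
      - payment (hpg tie B) \<omega> bs i"
  proof (cases "\<exists>j<length bs. hpg_assign tie B \<omega> (take (Suc j) bs) = Some i")
    case True
    then obtain j where j: "j < length bs" "hpg_assign tie B \<omega> (take (Suc j) bs) = Some i" by blast
    have "(\<Sum>k<length bs. hpg_charge tie B \<omega> (take (Suc k) bs) i) =
      (\<Sum>k<length bs. if k = j then hpg_charge tie B \<omega> (take (Suc j) bs) i else 0)"
    proof (intro sum.cong refl)
      fix k assume k: "k \<in> {..<length bs}"
      show "hpg_charge tie B \<omega> (take (Suc k) bs) i =
        (if k = j then hpg_charge tie B \<omega> (take (Suc j) bs) i else 0)"
      proof (cases "k = j")
        case False
        then have "hpg_assign tie B \<omega> (take (Suc k) bs) \<noteq> Some i"
          using hpg_assign_once[OF j(2) _ j(1)] k by blast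
        then show ?thesis using False by (simp add: hpg_charge_unassigned)
      qed simp
    qed
    then have p: "payment (hpg tie B) \<omega> bs i = hpg_charge tie B \<omega> (take (Suc j) bs) i"
      using j(1) by (simp add: pay)
    have l: "last (take (Suc j) bs) = bs ! j" using j(1) by (simp add: take_Suc_conv_app_nth)
    have e: "(i, j) \<in> edges G" "bid (bs ! j) i = val G i"
      using hpg_assign_SomeD(3)[OF j(2)] truth j(1) len
      by (auto simp: l true_decl_def bid_def split: if_splits)
    have "hpg_charge tie B \<omega> (take (Suc j) bs) i \<le> bid (last (take (Suc j) bs)) i"
      using space_hpg[OF \<omega>] vb j(1) by (intro hpg_charge_le_bid j(2)) (auto simp: l valid_bids_def)
    then have "payment (hpg tie B) \<omega> bs i \<le> val G i" using p e l by simp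
    moreover have "satisfied G (outcome (hpg tie B) \<omega> bs) i"
      using e j unfolding satisfied_def outcome_def by (auto simp: hpg_def)
    ultimately show ?thesis by simp
  next
    case False
    then have "payment (hpg tie B) \<omega> bs i = 0"
      unfolding pay by (intro sum.neutral) (auto intro!: hpg_charge_unassigned)
    then show ?thesis using v by simp
  qed
qed

text \<open>The price \<open>q\<close> is determined by the history, the perturbations and the other
  bids; a declaration of buyer \<open>i\<close> only decides whether she wins at that price. If
  winning is profitable for her, the truth wins as well.\<close>

lemma truthful_myopic_hpg: "truthful_myopic B (hpg tie B)"
  unfolding truthful_myopic_def Let_def
proof (intro ballI allI impI, elim conjE)
  fix G \<omega> h b d i
  assume wf: "wf_market G" and G: "buyers G = B" and \<omega>: "\<omega> \<in> space (rand (hpg tie B))"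
    and i: "i \<in> B" and len: "length h < n_items G"
    and vt: "valid_bids B (h @ [b(i := true_decl G (length h) i)])"
    and vl: "valid_bids B (h @ [b(i := d)])"
  define bt where "bt = b(i := true_decl G (length h) i)"
  define bl where "bl = b(i := d)"
  define D where "D = hpg_discarded tie B \<omega> h"
  define v where "v = val G i"
  define E where "E \<longleftrightarrow> (i, length h) \<in> edges G"
  define c where "c = (\<lambda>b'. hpg_choice tie B \<omega> D b')"
  define R where "R = hpg_N B D b - {i}"
  define q where "q = (if R = {} then 0 else Max ((\<lambda>k. hpg_y \<omega> k / hpg_y \<omega> i * bid b k) ` R))"
  have v: "0 \<le> v" using wf i G by (auto simp: wf_market_def v_def)
  have nnt: "0 \<le> bid bt k" and nnl: "0 \<le> bid bl k" for k
    using vt vl by (auto simp: valid_bids_def bt_def bl_def)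
  have x: "\<omega> k \<in> {0..1}" if "k \<in> B" for k using space_hpg \<omega> that by blast
  have yi: "0 \<le> hpg_y \<omega> i" using x[OF i] by (rule hpg_y_nonneg)
  have N: "hpg_N B D (b(i := e)) - {i} = R" for e by (auto simp: R_def hpg_N_def)
  have asg: "hpg_assign tie B \<omega> (h @ [b']) = c b'" for b'
    by (simp add: hpg_assign_def c_def D_def)
  have chg: "hpg_charge tie B \<omega> (h @ [b(i := e)]) i = (if c (b(i := e)) = Some i then q else 0)" for e
  proof -
    have "Max ((\<lambda>k. hpg_y \<omega> k / hpg_y \<omega> i * bid (b(i := e)) k) ` R) =
        Max ((\<lambda>k. hpg_y \<omega> k / hpg_y \<omega> i * bid b k) ` R)"
      by (intro arg_cong[where f = Max] image_cong) (auto simp: R_def bid_def)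
    then show ?thesis
      by (simp add: hpg_charge_def asg D_def[symmetric] N Let_def q_def)
  qed
  have ut: "round_utility G (hpg tie B) \<omega> (h @ [bt]) i =
      v * of_bool (c bt = Some i \<and> E) - (if c bt = Some i then q else 0)"
    using asg chg by (simp add: round_utility_def hpg_def bt_def v_def E_def)
  have ul: "round_utility G (hpg tie B) \<omega> (h @ [bl]) i =
      v * of_bool (c bl = Some i \<and> E) - (if c bl = Some i then q else 0)"
    using asg chg by (simp add: round_utility_def hpg_def bl_def v_def E_def)
  have ql: "0 \<le> q" if "c bl = Some i"
    using hpg_charge_nonneg[of \<omega> "h @ [bl]" i] x nnl chg[of d] that by (simp add: bl_def)
  have tE: "E" if "c bt = Some i"
    using hpg_choice_SomeD(1)[OF that[unfolded c_def]]
    by (auto simp: hpg_N_def bt_def true_decl_def E_def split: if_splits)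
  have bv: "bid bt i = v" if E using that by (simp add: bt_def bid_def true_decl_def E_def v_def)
  have qt: "q \<le> v" if "c bt = Some i"
    using hpg_charge_le_bid[of \<omega> "h @ [bt]" i] x nnt that chg[of "true_decl G (length h) i"]
      bv[OF tE[OF that]] by (simp add: asg) (simp add: bt_def)
  have ut0: "0 \<le> round_utility G (hpg tie B) \<omega> (h @ [bt]) i"
    using qt tE by (auto simp: ut)
  show "round_utility G (hpg tie B) \<omega> (h @ [b(i := d)]) i
      \<le> round_utility G (hpg tie B) \<omega> (h @ [b(i := true_decl G (length h) i)]) i"
  \<comment> \<open>Only a lie that wins a wanted item at a price below the value has positive
    utility. In all other cases its utility is at most 0, hence at most that of the truth.\<close>
  proof (cases "c bl = Some i \<and> E \<and> q < v")
    case True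
    then have cl: "c bl = Some i" and E: E and qv: "q < v" by auto
    have iN: "i \<in> hpg_N B D bl" using hpg_choice_SomeD(1) cl by (simp add: c_def)
    then have iNt: "i \<in> hpg_N B D bt" using E by (auto simp: hpg_N_def bt_def true_decl_def E_def)
    have Neq: "hpg_N B D bl = hpg_N B D bt"
      using iN iNt unfolding bl_def bt_def hpg_N_def by auto
    have "c bt = Some i"
    \<comment> \<open>With factor 0 the perturbed bid of \<open>i\<close> is 0 whatever she
      declares, so both declarations yield the same maximizers and \<open>tie\<close> picks the same
      winner.\<close>
    proof (cases "hpg_y \<omega> i = 0")
      case True
      have "(\<lambda>i. bid bl i * hpg_y \<omega> i) = (\<lambda>i. bid bt i * hpg_y \<omega> i)"
        using True by (auto simp: fun_eq_iff bl_def bt_def bid_def)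
      then have "c bt = c bl" unfolding c_def hpg_choice_def Neq by simp
      then show ?thesis using cl by simp
    next
      case False
      then have y: "0 < hpg_y \<omega> i" using yi by simp
      obtain k where k: "c bt = Some k"
        using iNt hpg_choice_None_iff[of \<omega> D bt] unfolding c_def by (cases "hpg_choice tie B \<omega> D bt") auto
      have kN: "k \<in> hpg_N B D bt" and kmax: "bid bt i * hpg_y \<omega> i \<le> bid bt k * hpg_y \<omega> k"
        using hpg_choice_SomeD k iNt by (auto simp: c_def)
      \<comment> \<open>Another winner \<open>k\<close> would have a perturbed bid of at least
        \<open>v * hpg_y \<omega> i\<close>; her term in the maximum defining \<open>q\<close> would
        then be at least \<open>v\<close>.\<close>
      have "k = i"
      proof (rule ccontr)
        assume ne: "k \<noteq> i"
        then have kR: "k \<in> R" using kN N by (auto simp: bt_def)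
        have "finite R" using finB by (simp add: R_def hpg_N_def)
        then have "hpg_y \<omega> k / hpg_y \<omega> i * bid b k \<le> q"
          using kR by (auto simp: q_def intro!: Max_ge)
        also have "q < v" by fact
        finally have "hpg_y \<omega> k * bid b k < v * hpg_y \<omega> i" using y by (simp add: field_simps)
        moreover have "bid bt k = bid b k" using ne by (simp add: bt_def bid_def)
        ultimately show False using kmax bv[OF E] by (simp add: mult.commute)
      qed
      then show ?thesis using k by simp
    qed
    then show ?thesis using ut ul cl E by (simp add: bt_def bl_def)
  next
    case False
    then have "round_utility G (hpg tie B) \<omega> (h @ [bl]) i \<le> 0" using ql v by (auto simp: ul not_less)
    then show ?thesis using ut0 unfolding bl_def bt_def by linarith
  qed
qed

section \<open>Measurability of the allocation\<close>

lemma hpg_choice_measurable: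
  "(\<lambda>x. hpg_choice tie B x D b) \<in>
     measurable (cube B) (count_space UNIV)"
proof (cases "hpg_N B D b = {}")
  case True
  then show ?thesis by (simp add: hpg_choice_def)
next
  case False
  let ?M = "cube B"
  let ?S = "\<lambda>x. {i. is_arg_max (\<lambda>i. bid b i * hpg_y x i) (\<lambda>i. i \<in> hpg_N B D b) i}"
  have NB: "hpg_N B D b \<subseteq> B" by (auto simp: hpg_N_def)
  then have fN: "finite (hpg_N B D b)" using finB finite_subset by blast
  \<comment> \<open>As \<open>tie\<close> is an arbitrary function, measurability is proved for the
    set of maximizers instead. It takes finitely many values, each on an event given by finitely
    many comparisons, and any function of it is then measurable.\<close>
  have "?S \<in> measurable ?M (count_space (Pow B))"
  proof (subst measurable_count_space_eq2, intro finite_Pow_iff[THEN iffD2] finB, intro conjI ballI)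
    show "?S \<in> space ?M \<rightarrow> Pow B"
      using NB by (auto simp: is_arg_max_def)
  next
    fix T
    have T: "?S x = T \<longleftrightarrow> (T \<subseteq> hpg_N B D b \<and> (\<forall>i\<in>hpg_N B D b. i \<in> T \<longleftrightarrow>
        (\<forall>k\<in>hpg_N B D b. bid b k * hpg_y x k \<le> bid b i * hpg_y x i)))" for x
      by (auto simp: is_arg_max_def not_less)
    have "Measurable.pred ?M (\<lambda>x. bid b k * hpg_y x k \<le> bid b i * hpg_y x i)"
      if "i \<in> hpg_N B D b" "k \<in> hpg_N B D b" for i k
    proof -
      have "(\<lambda>x. hpg_y x k) \<in> borel_measurable ?M" "(\<lambda>x. hpg_y x i) \<in> borel_measurable ?M"
        using hpg_y_measurable NB that by blast+
      then show ?thesis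
        unfolding pred_def by (intro borel_measurable_le borel_measurable_times borel_measurable_const)
    qed
    then have "Measurable.pred ?M (\<lambda>x. ?S x = T)"
      unfolding T by (intro pred_intros_logic pred_intros_finite fN) auto
    then have "{x \<in> space ?M. ?S x = T} \<in> sets ?M"
      by (simp add: pred_def)
    then show "?S -` {T} \<inter> space ?M \<in> sets ?M" 
      by (simp add: vimage_def Collect_conj_eq Int_commute)
  qed
  then have "(\<lambda>x. Some (tie (?S x))) \<in> measurable ?M (count_space UNIV)"
    by (rule measurable_compose) simp
  then show ?thesis using False by (simp add: hpg_choice_def)
qed

lemma hpg_choice_set: "set_option (hpg_choice tie B x D b) \<subseteq> B"
  using hpg_choice_SomeD(1)[of x D b] by (auto simp: hpg_N_def)

lemma hpg_discarded_measurable: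
  "(\<lambda>x. hpg_discarded tie B x bs) \<in>
     measurable (cube B) (count_space (Pow B))"
proof (induction bs rule: rev_induct)
  case Nil
  then show ?case by (simp add: hpg_discarded_def)
next
  case (snoc b bs)
  have "(\<lambda>x. D \<union> set_option (hpg_choice tie B x D b)) \<in>
      measurable (cube B) (count_space (Pow B))"
    if "D \<in> Pow B" for D
  proof -
    \<comment> \<open>The intersection with \<open>B\<close> makes the map land in
      \<open>Pow B\<close> for every option; on actual choices it changes nothing.\<close>
    have "(\<lambda>c. D \<union> (set_option c \<inter> B)) \<in> measurable (count_space UNIV) (count_space (Pow B))"
      using that by auto
    from measurable_compose[OF hpg_choice_measurable this]
    show ?thesis using hpg_choice_set by (simp add: Int_absorb2)
  qed
  from measurable_compose_countable'[OF this snoc.IH] finB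
  show ?case by (simp add: hpg_discarded_def countable_finite)
qed

lemma hpg_assign_measurable:
  "(\<lambda>x. hpg_assign tie B x bs) \<in>
     measurable (cube B) (count_space UNIV)"
proof (cases "bs = []")
  case False
  from measurable_compose_countable'[OF hpg_choice_measurable hpg_discarded_measurable] finB
  have "(\<lambda>x. hpg_choice tie B x (hpg_discarded tie B x (butlast bs)) (last bs)) \<in>
     measurable (cube B) (count_space UNIV)"
    by (simp add: countable_finite)
  with False show ?thesis by (simp add: hpg_assign_def)
qed (simp add: hpg_assign_def)

lemma online_mechanism_hpg: "online_mechanism B (hpg tie B)"
  unfolding online_mechanism_def online_algorithm_def
proof (intro conjI ballI allI impI; (elim conjE)?)
  show "prob_space (rand (hpg tie B))" by (simp add: rand_hpg prob_space_cube)
  fix bs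
  show "assign (hpg tie B) \<omega> bs = Some i \<Longrightarrow> i \<in> B" for \<omega> i
    using hpg_assign_SomeD(2) by (simp add: hpg_def)
  show "assign (hpg tie B) \<omega> bs = Some i \<Longrightarrow> last bs i \<noteq> None" for \<omega> i
    using hpg_assign_SomeD(3) by (simp add: hpg_def)
  show "(\<lambda>\<omega>. assign (hpg tie B) \<omega> bs) \<in> rand (hpg tie B) \<rightarrow>\<^sub>M count_space UNIV"
    using hpg_assign_measurable unfolding rand_hpg by (simp add: hpg_def)
  show "outcome (hpg tie B) \<omega> bs j \<noteq> Some i"
    if "assign (hpg tie B) \<omega> bs = Some i" "j < length bs - 1" for \<omega> i j
  proof
    assume "outcome (hpg tie B) \<omega> bs j = Some i"
    then have "hpg_assign tie B \<omega> (take (Suc j) bs) = Some i"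
      by (simp add: outcome_def hpg_def split: if_splits)
    moreover have "hpg_assign tie B \<omega> (take (Suc (length bs - 1)) bs) = Some i"
      using that by (simp add: hpg_def)
    ultimately have "j = length bs - 1"
      using that(2) by (intro hpg_assign_once) auto
    with that(2) show False by simp
  qed
  show "0 \<le> charge (hpg tie B) \<omega> bs i"
    if "\<omega> \<in> space (rand (hpg tie B))" "valid_bids B bs" "bs \<noteq> []" for \<omega> i
  proof -
    have "0 \<le> hpg_charge tie B \<omega> bs i"
      using that space_hpg[OF that(1)] by (intro hpg_charge_nonneg) (auto simp: valid_bids_def)
    then show ?thesis by (simp add: hpg_def)
  qed
qed

end

section \<open>The competitive ratio\<close>

text \<open>Tied maximizers are all selected at once. This makes the comparison of the runs with and
  without a given buyer independent of how ties are broken; ties between positive weights have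
  probability \<open>0\<close> in the end.\<close>

definition top_set :: "(nat \<Rightarrow> real) \<Rightarrow> nat set \<Rightarrow> nat set" where
  "top_set w S = {k\<in>S. 0 < w k \<and> (\<forall>l\<in>S. w l \<le> w k)}"

primrec greedy :: "(nat \<Rightarrow> nat set) \<Rightarrow> (nat \<Rightarrow> real) \<Rightarrow> nat \<Rightarrow> nat set" where
  "greedy N w 0 = {}"
| "greedy N w (Suc j) = greedy N w j \<union> top_set w (N j - greedy N w j)"

text \<open>For nonnegative weights this is the largest weight still available when item
  \<open>j\<close> arrives. Buyers already selected enter with weight 0 instead of being left out,
  so the maximum runs over a fixed index set, which suits measurability; the inserted 0 covers an
  empty neighbourhood.\<close>

definition item_dual :: "(nat \<Rightarrow> nat set) \<Rightarrow> (nat \<Rightarrow> real) \<Rightarrow> nat \<Rightarrow> real" where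
  "item_dual N w j = Max (insert 0 ((\<lambda>k. if k \<in> greedy N w j then 0 else w k) ` N j))"

lemma greedy_mono: "j \<le> k \<Longrightarrow> greedy N w j \<subseteq> greedy N w k"
  by (rule lift_Suc_mono_le[of "greedy N w"]) auto

lemma greedy_subset: "(\<And>j. N j \<subseteq> B) \<Longrightarrow> greedy N w j \<subseteq> B"
  by (induction j) (auto simp: top_set_def)

lemma item_dual_nonneg: "finite (N j) \<Longrightarrow> 0 \<le> item_dual N w j"
  by (simp add: item_dual_def)

lemma item_dual_ge: "finite (N j) \<Longrightarrow> k \<in> N j \<Longrightarrow> k \<notin> greedy N w j \<Longrightarrow> w k \<le> item_dual N w j"
  unfolding item_dual_def by (intro Max_ge) auto

lemma item_dual_le:
  "finite (N j) \<Longrightarrow> 0 \<le> c \<Longrightarrow> (\<And>k. k \<in> N j \<Longrightarrow> k \<notin> greedy N w j \<Longrightarrow> w k \<le> c) \<Longrightarrow>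
    item_dual N w j \<le> c"
  unfolding item_dual_def by (subst Max_le_iff) auto

text \<open>Setting \<open>w i\<close> to \<open>0\<close> removes \<open>i\<close> from the market, since \<^const>\<open>greedy\<close> never selects
  an element of weight \<open>0\<close>.\<close>

lemma greedy_remove_subset: "greedy N w j - {i} \<subseteq> greedy N (w(i := 0)) j"
proof (induction j)
  case (Suc j)
  have "k \<in> greedy N (w(i := 0)) (Suc j)"
    if k: "k \<in> top_set w (N j - greedy N w j)" "k \<noteq> i" "k \<notin> greedy N (w(i := 0)) j" for k
  proof -
    have "w l \<le> w k" if "l \<in> N j" "l \<notin> greedy N (w(i := 0)) j" "l \<noteq> i" for l
      using k Suc.IH that unfolding top_set_def by blast
    then show ?thesis using k by (auto simp: top_set_def)
  qed
  with Suc.IH show ?case unfolding greedy.simps by blast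
qed simp

text \<open>A buyer can displace others only by outweighing all of them, and then she is selected
  herself.\<close>

lemma greedy_remove_eq: "i \<notin> greedy N w j \<Longrightarrow> greedy N (w(i := 0)) j = greedy N w j"
proof (induction j)
  case (Suc j)
  define S where "S = N j - greedy N w j"
  have IH: "greedy N (w(i := 0)) j = greedy N w j" and ni: "i \<notin> top_set w S"
    using Suc.IH Suc.prems unfolding greedy.simps S_def by blast+
  have "k \<in> top_set w S" if k: "k \<in> top_set (w(i := 0)) S" for k
  proof -
    have ki: "k \<noteq> i" using k by (auto simp: top_set_def)
    have wk: "k \<in> S" "0 < w k" "\<And>l. l \<in> S \<Longrightarrow> l \<noteq> i \<Longrightarrow> w l \<le> w k"
      using k ki by (auto simp: top_set_def split: if_splits)
    have "w i \<le> w k" if "i \<in> S"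
    proof (rule ccontr)
      assume "\<not> w i \<le> w k"
      then have "w l \<le> w i" if "l \<in> S" for l
        using wk(3)[OF that] by (cases "l = i") auto
      then have "i \<in> top_set w S"
        using wk(2) that \<open>\<not> w i \<le> w k\<close> unfolding top_set_def by auto
      with ni show False by simp
    qed
    then show ?thesis using wk unfolding top_set_def by blast
  qed
  moreover have "k \<in> top_set (w(i := 0)) S" if "k \<in> top_set w S" for k
    using that ni by (cases "k = i") (auto simp: top_set_def)
  ultimately have "top_set (w(i := 0)) S = top_set w S" by blast
  then show ?case unfolding greedy.simps IH S_def by blast
qed simp

text \<open>By \<open>greedy_remove_subset\<close>, any other buyer still available in the run
  without \<open>i\<close> is also available in the run with \<open>i\<close>, so the maximum there
  ranges over more positive weights.\<close>

lemma item_dual_remove_le: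
  assumes "finite (N j)"
  shows "item_dual N (w(i := 0)) j \<le> item_dual N w j"
proof (rule item_dual_le)
  show "finite (N j)" "0 \<le> item_dual N w j"
    using assms item_dual_nonneg[of N j w] by auto
  fix k assume k: "k \<in> N j" "k \<notin> greedy N (w(i := 0)) j"
  show "(w(i := 0)) k \<le> item_dual N w j"
  proof (cases "k = i")
    case True
    then show ?thesis using item_dual_nonneg[of N j w] assms by simp
  next
    case False
    then have "k \<notin> greedy N w j" using greedy_remove_subset[of N w j i] k by blast
    then show ?thesis using item_dual_ge[of N j k w] assms k False by simp
  qed
qed

text \<open>If \<open>i\<close> were still unselected after item \<open>j\<close>, both runs would
  agree up to \<open>j\<close>. All rivals for \<open>j\<close> would then weigh at most the
  threshold, which makes \<open>i\<close> a top element for \<open>j\<close>.\<close>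

lemma greedy_above_threshold:
  assumes "finite (N j)" "i \<in> N j" "item_dual N (w(i := 0)) j < w i" "Suc j \<le> n"
  shows "i \<in> greedy N w n"
proof -
  have "i \<in> greedy N w (Suc j)"
  proof (rule ccontr)
    assume n: "i \<notin> greedy N w (Suc j)"
    then have eq: "greedy N (w(i := 0)) j = greedy N w j" by (intro greedy_remove_eq) auto
    have "w l \<le> w i" if "l \<in> N j - greedy N w j" for l
      using item_dual_ge[of N j l "w(i := 0)"] that assms eq by (cases "l = i") auto
    moreover have "0 < w i" using item_dual_nonneg[of N j "w(i := 0)"] assms by linarith
    ultimately have "i \<in> greedy N w (Suc j)" using assms n by (auto simp: top_set_def)
    with n show False by blast
  qed
  then show ?thesis using greedy_mono[OF assms(4)] by blast
qed

text \<open>The dual of an item is paid by the buyers selected for it: a positive maximal available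
  weight belongs to a member of the top set. Ties may select several buyers, hence only an
  inequality.\<close>

lemma sum_item_dual_le:
  assumes fin: "\<And>j. finite (N j)"
  shows "(\<Sum>j<n. item_dual N w j) \<le> (\<Sum>k\<in>greedy N w n. w k)"
proof (induction n)
  case (Suc n)
  define S where "S = N n - greedy N w n"
  have finS: "finite S" and fing: "finite (greedy N w n)" 
    using fin by (auto simp: S_def) (induction n, auto simp: fin top_set_def)
  have ftop: "finite (top_set w S)" using finS by (auto simp: top_set_def)
  have "item_dual N w n \<le> (\<Sum>k\<in>top_set w S. w k)"
  proof (rule item_dual_le)
    show "0 \<le> (\<Sum>k\<in>top_set w S. w k)" by (intro sum_nonneg) (auto simp: top_set_def)
    fix k assume "k \<in> N n" "k \<notin> greedy N w n"
    then have kS: "k \<in> S" by (simp add: S_def)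
    show "w k \<le> (\<Sum>k\<in>top_set w S. w k)"
    proof (cases "0 < w k")
      case True
      have "Max (w ` S) \<in> w ` S" using finS kS by (intro Max_in) auto
      then obtain m where m: "m \<in> S" "w m = Max (w ` S)" by auto
      then have mx: "\<And>l. l \<in> S \<Longrightarrow> w l \<le> w m" using finS by simp
      then have "m \<in> top_set w S"
        using m(1) less_le_trans[OF True mx[OF kS]] by (auto simp: top_set_def)
      then have "w m \<le> (\<Sum>k\<in>top_set w S. w k)"
        using ftop by (intro member_le_sum) (auto simp: top_set_def)
      with mx[OF kS] show ?thesis by linarith
    next
      case False
      moreover have "0 \<le> (\<Sum>k\<in>top_set w S. w k)" by (intro sum_nonneg) (auto simp: top_set_def)
      ultimately show ?thesis by linarith
    qed
  qed (rule fin)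
  moreover have "(\<Sum>k\<in>greedy N w (Suc n). w k) = (\<Sum>k\<in>greedy N w n. w k) + (\<Sum>k\<in>top_set w S. w k)"
    using ftop fing by (simp add: S_def[symmetric]) (intro sum.union_disjoint, auto simp: top_set_def S_def)
  ultimately show ?case using Suc.IH by simp
qed simp

section \<open>Measurability of the greedy run\<close>

lemma greedy_measurable:
  assumes fin: "finite B" and NB: "\<And>j. N j \<subseteq> B"
    and w: "\<And>k. k \<in> B \<Longrightarrow> (\<lambda>x. w x k) \<in> borel_measurable M"
  shows "Measurable.pred M (\<lambda>x. k \<in> greedy N (w x) j)"
proof (induction j arbitrary: k)
  case (Suc j)
  have finN: "finite (N j)" using fin NB finite_subset by blast
  show ?case
  proof (cases "k \<in> N j")
    case True
    have "Measurable.pred M (\<lambda>x. 0 < w x k)"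
      using True NB w unfolding pred_def by (intro borel_measurable_less) auto
    moreover have "Measurable.pred M (\<lambda>x. w x l \<le> w x k)" if "l \<in> N j" for l
      using True that NB w unfolding pred_def by (intro borel_measurable_le) auto
    ultimately have "Measurable.pred M (\<lambda>x. k \<in> greedy N (w x) j \<or>
        (k \<notin> greedy N (w x) j \<and> 0 < w x k \<and> (\<forall>l\<in>N j. l \<notin> greedy N (w x) j \<longrightarrow> w x l \<le> w x k)))"
      using Suc.IH finN by (intro pred_intros_logic pred_intros_finite) auto
    then show ?thesis using True by (simp add: top_set_def Ball_def imp_conjL)
  next
    case False
    then show ?thesis using Suc.IH[of k] by (simp add: top_set_def)
  qed
qed simp

lemma item_dual_measurable:
  assumes fin: "finite B" and NB: "\<And>j. N j \<subseteq> B"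
    and w: "\<And>k. k \<in> B \<Longrightarrow> (\<lambda>x. w x k) \<in> borel_measurable M"
  shows "(\<lambda>x. item_dual N (w x) j) \<in> borel_measurable M"
proof (cases "N j = {}")
  case False
  have finN: "finite (N j)" using fin NB finite_subset by blast
  have "(\<lambda>x. if k \<in> greedy N (w x) j then 0 else w x k) \<in> borel_measurable M" if "k \<in> N j" for k
    using that NB w greedy_measurable[OF fin NB w, where k = k and j = j]
    by (intro measurable_If) (auto simp: pred_def)
  then have "(\<lambda>x. max 0 (Max ((\<lambda>k. if k \<in> greedy N (w x) j then 0 else w x k) ` N j))) \<in> borel_measurable M"
    using finN by (intro borel_measurable_max borel_measurable_Max) auto
  then show ?thesis using finN False unfolding item_dual_def by (subst Max_insert) auto
qed (simp add: item_dual_def)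

section \<open>Integration over a single perturbation\<close>

lemma threshold_integral:
  fixes p u :: real
  assumes p: "0 \<le> p" and u: "0 \<le> u"
  shows "ennreal ((1 - exp (-1)) * p) \<le>
    (\<integral>\<^sup>+t. ennreal (p * exp (t - 1) * of_bool (u < p * (1 - exp (t - 1))) + u)
      \<partial>restrict_space lborel {0..1})"
\<comment> \<open>For a large threshold the share \<open>u\<close> of the item suffices
  alone.\<close>
proof (cases "(1 - exp (-1)) * p \<le> u")
  case True
  interpret prob_space "restrict_space lborel {0..1::real}" by (rule prob_space_unit)
  have "ennreal ((1 - exp (-1)) * p) \<le> ennreal u" using True by (rule ennreal_leI)
  also have "\<dots> = (\<integral>\<^sup>+t. ennreal u \<partial>restrict_space lborel {0..1::real})"
    using emeasure_space_1 by simp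
  also have "\<dots> \<le> (\<integral>\<^sup>+t. ennreal (p * exp (t - 1) * of_bool (u < p * (1 - exp (t - 1))) + u)
      \<partial>restrict_space lborel {0..1})"
    using p by (intro nn_integral_mono ennreal_leI) auto
  finally show ?thesis .
next
  case False
  then have p0: "0 < p" using p u by (cases "p = 0") auto
  \<comment> \<open>The point \<open>c\<close> solves \<open>p * (1 - exp (c - 1)) = u\<close>, so
    the threshold is exceeded exactly for \<open>t < c\<close>. The integral of
    \<open>p * exp (t - 1)\<close> over \<open>{0..c}\<close> is
    \<open>(1 - exp (-1)) * p - u\<close>, precisely what \<open>u\<close> lacks.\<close>
  define c where "c = 1 + ln (1 - u / p)"
  have up: "exp (-1) < 1 - u / p" using False p0 by (simp add: field_simps)
  have pos: "0 < 1 - u / p" by (rule less_trans[OF exp_gt_zero up])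
  have ec: "exp (c - 1) = 1 - u / p" using pos by (simp add: c_def)
  have c0: "0 < c"
  proof -
    have "exp (-1) < exp (c - 1)" using up ec by simp
    then show ?thesis by simp
  qed
  have c1: "c \<le> 1"
  proof -
    have "exp (c - 1) \<le> exp 0" using ec u p0 by simp
    then show ?thesis by (simp only: exp_le_cancel_iff)
  qed
  have "(\<integral>\<^sup>+t. ennreal (p * exp (t - 1)) * indicator {0..c} t \<partial>lborel) =
      ennreal (p * exp (c - 1) - p * exp (0 - 1))"
    using p c0 by (intro nn_integral_FTC_Icc) (auto intro!: derivative_eq_intros)
  moreover have "(\<integral>\<^sup>+t. ennreal u * indicator {0..1::real} t \<partial>lborel) = ennreal u"
    by (subst nn_integral_cmult_indicator) auto
  ultimately have "(\<integral>\<^sup>+t. ennreal (p * exp (t - 1)) * indicator {0..c} t + ennreal u * indicator {0..1} t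
      \<partial>lborel) = ennreal (p * exp (c - 1) - p * exp (0 - 1)) + ennreal u"
    by (subst nn_integral_add) auto
  also have "\<dots> = ennreal ((1 - exp (-1)) * p)"
  proof -
    have "p * exp (0 - 1) \<le> p * exp (c - 1)" using p c0 by (intro mult_left_mono) auto
    then have "ennreal (p * exp (c - 1) - p * exp (0 - 1)) + ennreal u =
        ennreal (p * exp (c - 1) - p * exp (0 - 1) + u)"
      using u by (intro ennreal_plus[symmetric]) auto
    also have "p * exp (c - 1) - p * exp (0 - 1) + u = (1 - exp (-1)) * p"
      using p0 by (simp add: ec field_simps)
    finally show ?thesis .
  qed
  finally have "ennreal ((1 - exp (-1)) * p) =
    (\<integral>\<^sup>+t. ennreal (p * exp (t - 1)) * indicator {0..c} t + ennreal u * indicator {0..1} t \<partial>lborel)" ..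
  also have "\<dots> \<le> (\<integral>\<^sup>+t. ennreal (p * exp (t - 1) * of_bool (u < p * (1 - exp (t - 1))) + u)
      * indicator {0..1} t \<partial>lborel)"
  proof (rule nn_integral_mono_AE)
    \<comment> \<open>At \<open>t = c\<close> the strict inequality fails although \<open>c\<close>
      lies in \<open>{0..c}\<close>; this point is discarded as a null set.\<close>
    show "AE t in lborel. ennreal (p * exp (t - 1)) * indicator {0..c} t + ennreal u * indicator {0..1} t
      \<le> ennreal (p * exp (t - 1) * of_bool (u < p * (1 - exp (t - 1))) + u) * indicator {0..1} t"
      using AE_lborel_singleton[of c]
    proof eventually_elim
      case (elim t)
      show ?case
      proof (cases "0 \<le> t \<and> t < c")
        case True
        then have "exp (t - 1) < exp (c - 1)" by simp
        then have "u < p * (1 - exp (t - 1))" using p0 by (simp add: ec field_simps)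
        then show ?thesis using True c1 p u by (simp add: ennreal_plus)
      next
        case False
        then have "t \<notin> {0..c}" using elim by auto
        then show ?thesis using p u by (auto simp: indicator_def intro!: ennreal_leI)
      qed
    qed
  qed
  also have "\<dots> = (\<integral>\<^sup>+t. ennreal (p * exp (t - 1) * of_bool (u < p * (1 - exp (t - 1))) + u)
      \<partial>restrict_space lborel {0..1})"
    by (subst nn_integral_restrict_space) auto
  finally show ?thesis .
qed

text \<open>Tonelli's theorem for one coordinate, used to average over the perturbation of
  \<open>i\<close> while the others are held fixed.\<close>

lemma nn_integral_cube:
  assumes "finite B" "i \<in> B" "f \<in> borel_measurable (cube B)"
  shows "(\<integral>\<^sup>+x. f x \<partial>cube B) =
    (\<integral>\<^sup>+x. (\<integral>\<^sup>+t. f (x(i := t)) \<partial>restrict_space lborel {0..1}) \<partial>cube (B - {i}))"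
proof -
  interpret product_sigma_finite "\<lambda>_::nat. restrict_space lborel {0..1::real}"
    by (rule product_sigma_finite.intro)
      (use prob_space_unit in \<open>auto intro: prob_space_imp_sigma_finite\<close>)
  have "insert i (B - {i}) = B" using assms(2) by auto
  then show ?thesis
    using product_nn_integral_insert[of "B - {i}" i f] assms unfolding cube_def by simp
qed

text \<open>With the other coordinates fixed, a positive tie forces \<open>v a\<close> to be nonzero
  and pins \<open>x a\<close> to the single point \<open>1 + ln (1 - s / v a)\<close>, a null
  set.\<close>

lemma perturbed_no_ties:
  assumes fin: "finite B" and ab: "a \<in> B" "b \<in> B" "a \<noteq> b"
  shows "AE x in cube B. \<not> (v a * hpg_y x a = v b * hpg_y x b \<and> 0 < v b * hpg_y x b)"
proof -
  let ?P = "\<lambda>x. v a * hpg_y x a = v b * hpg_y x b \<and> 0 < v b * hpg_y x b"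
  have [measurable]: "Measurable.pred (cube B) ?P"
    unfolding pred_def using ab
    by (intro sets.sets_Collect_conj borel_measurable_eq borel_measurable_less borel_measurable_times
      borel_measurable_const hpg_y_measurable)
  have "(\<integral>\<^sup>+t. of_bool (?P (x(a := t))) \<partial>restrict_space lborel {0..1}) = (0::ennreal)" for x
  proof -
    define s where "s = v b * hpg_y x b"
    have "AE t in lborel. t \<in> {0..1} \<longrightarrow> of_bool (?P (x(a := t))) = (0::ennreal)"
      using AE_lborel_singleton[of "1 + ln (1 - s / v a)"]
    proof eventually_elim
      case (elim t)
      have "\<not> ?P (x(a := t))"
      proof
        assume "?P (x(a := t))"
        then have "v a * (1 - exp (t - 1)) = s" "0 < s"
          using ab by (auto simp: hpg_y_def s_def)
        then have "exp (t - 1) = 1 - s / v a" by (cases "v a = 0") (auto simp: field_simps)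
        then have "t - 1 = ln (1 - s / v a)" by (metis ln_exp)
        with elim show False by simp
      qed
      then show ?case by simp
    qed
    then have "AE t in restrict_space lborel {0..1}. of_bool (?P (x(a := t))) = (0::ennreal)"
      by (subst AE_restrict_space_iff) auto
    then have "(\<integral>\<^sup>+t. of_bool (?P (x(a := t))) \<partial>restrict_space lborel {0..1}) =
        (\<integral>\<^sup>+t. (0::ennreal) \<partial>restrict_space lborel {0..1::real})"
      by (rule nn_integral_cong_AE)
    then show ?thesis by simp
  qed
  then have "(\<integral>\<^sup>+x. of_bool (?P x) \<partial>cube B) = (0::ennreal)"
    using fin ab(1) by (subst nn_integral_cube[where i = a]) auto
  then have "AE x in cube B. of_bool (?P x) = (0::ennreal)"
    by (subst (asm) nn_integral_0_iff_AE) auto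
  then show ?thesis by eventually_elim auto
qed


section \<open>From greedy runs to the mechanism, and the primal-dual bound\<close>

context
  fixes tie :: "nat set \<Rightarrow> nat" and G :: market
  assumes tie: "\<And>S. finite S \<Longrightarrow> S \<noteq> {} \<Longrightarrow> tie S \<in> S" and wf: "wf_market G"
begin

definition nbrs :: "nat \<Rightarrow> nat set" where
  "nbrs j = {i. (i, j) \<in> edges G}"

definition pval :: "(nat \<Rightarrow> real) \<Rightarrow> nat \<Rightarrow> real" where
  "pval x k = val G k * hpg_y x k"

lemma finite_buyers: "finite (buyers G)"
  using wf by (simp add: wf_market_def)

lemma nbrs_subset: "nbrs j \<subseteq> buyers G"
  using wf by (auto simp: nbrs_def wf_market_def)

lemma finite_nbrs: "finite (nbrs j)"
  using finite_buyers nbrs_subset finite_subset by blast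

lemma val_nonneg: "k \<in> buyers G \<Longrightarrow> 0 \<le> val G k"
  using wf by (simp add: wf_market_def)

lemma pval_measurable: "k \<in> buyers G \<Longrightarrow> (\<lambda>x. pval x k) \<in> borel_measurable (cube (buyers G))"
  unfolding pval_def by (intro borel_measurable_times borel_measurable_const hpg_y_measurable)

text \<open>Without positive ties a top set has at most one element, and this is the choice of the
  mechanism. A buyer of perturbed value 0 may be served by the mechanism though never by
  \<open>greedy\<close>, but only when no positive competitor is left, so the positive parts evolve
  alike.\<close>

lemma hpg_discarded_positive:
  assumes inj: "inj_on (pval x) {k\<in>buyers G. 0 < pval x k}" and j: "j \<le> n_items G"
  shows "hpg_discarded tie (buyers G) x (take j (truthful_bids G)) \<inter> {k. 0 < pval x k} =
    greedy nbrs (pval x) j"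
  using j
proof (induction j)
  case 0
  then show ?case by (simp add: hpg_discarded_def)
next
  case (Suc j)
  define D where "D = hpg_discarded tie (buyers G) x (take j (truthful_bids G))"
  define c where "c = hpg_choice tie (buyers G) x D (true_decl G j)"
  have IH: "D \<inter> {k. 0 < pval x k} = greedy nbrs (pval x) j" using Suc by (simp add: D_def)
  have "take (Suc j) (truthful_bids G) = take j (truthful_bids G) @ [true_decl G j]"
    using Suc.prems by (simp add: truthful_bids_def take_Suc_conv_app_nth)
  then have D': "hpg_discarded tie (buyers G) x (take (Suc j) (truthful_bids G)) = D \<union> set_option c"
    by (simp add: hpg_discarded_def D_def c_def)
  have N: "hpg_N (buyers G) D (true_decl G j) = nbrs j - D"
    using nbrs_subset by (auto simp: hpg_N_def true_decl_def nbrs_def)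
  have b: "bid (true_decl G j) k * hpg_y x k = pval x k" if "k \<in> nbrs j" for k
    using that by (simp add: bid_def true_decl_def nbrs_def pval_def)
  have "set_option c \<inter> {k. 0 < pval x k} = top_set (pval x) (nbrs j - greedy nbrs (pval x) j)"
  proof (cases c)
    case None
    then have "nbrs j - D = {}"
      using hpg_choice_None_iff[OF tie finite_buyers, of x D "true_decl G j"] by (simp add: c_def N)
    then show ?thesis using None IH by (auto simp: top_set_def)
  next
    case (Some m)
    have m: "m \<in> nbrs j - D" "\<And>k. k \<in> nbrs j - D \<Longrightarrow> pval x k \<le> pval x m"
      using hpg_choice_SomeD[OF tie finite_buyers Some[unfolded c_def]] b unfolding N by auto
    have le: "pval x k \<le> pval x m" if "k \<in> nbrs j - greedy nbrs (pval x) j" "0 < pval x k" for k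
      using that m(2) IH by blast
    show ?thesis
    proof (cases "0 < pval x m")
      case True
      have "k = m" if "k \<in> top_set (pval x) (nbrs j - greedy nbrs (pval x) j)" for k
      proof (rule inj_onD[OF inj])
        have k: "k \<in> nbrs j - greedy nbrs (pval x) j" "0 < pval x k"
          "\<And>l. l \<in> nbrs j - greedy nbrs (pval x) j \<Longrightarrow> pval x l \<le> pval x k"
          using that by (auto simp: top_set_def)
        have "m \<in> nbrs j - greedy nbrs (pval x) j" using m(1) IH by blast
        then show "pval x k = pval x m" using k(3) le[OF k(1,2)] by force
        show "k \<in> {k \<in> buyers G. 0 < pval x k}" "m \<in> {k \<in> buyers G. 0 < pval x k}"
          using k(1,2) m(1) True nbrs_subset by blast+
      qed
      moreover have "m \<in> top_set (pval x) (nbrs j - greedy nbrs (pval x) j)"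
      proof -
        have "m \<in> nbrs j - greedy nbrs (pval x) j" using m(1) IH by blast
        moreover have "pval x l \<le> pval x m" if "l \<in> nbrs j - greedy nbrs (pval x) j" for l
          using le[OF that] True by (cases "0 < pval x l") auto
        ultimately show ?thesis using True by (simp add: top_set_def)
      qed
      ultimately have "top_set (pval x) (nbrs j - greedy nbrs (pval x) j) = {m}" by blast
      then show ?thesis using Some True by simp
    next
      case False
      then have "k \<notin> top_set (pval x) (nbrs j - greedy nbrs (pval x) j)" for k
        using le[of k] unfolding top_set_def by force
      then show ?thesis using Some False by auto
    qed
  qed
  then show ?case unfolding D' greedy.simps IH[symmetric] by blast
qed

text \<open>Items go only to buyers declaring interest, and truthful declarations of interest are
  the edges; hence a buyer is satisfied exactly if she is discarded.\<close>

lemma SW_hpg: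
  "SW G (outcome (hpg tie (buyers G)) x (truthful_bids G)) =
    (\<Sum>i\<in>buyers G. val G i * of_bool (i \<in> hpg_discarded tie (buyers G) x (truthful_bids G)))"
proof -
  have len: "length (truthful_bids G) = n_items G" by (simp add: truthful_bids_def)
  have "(i, j) \<in> edges G"
    if "hpg_assign tie (buyers G) x (take (Suc j) (truthful_bids G)) = Some i" "j < n_items G" for i j
  proof -
    have "last (take (Suc j) (truthful_bids G)) = true_decl G j"
      using that(2) by (simp add: take_Suc_conv_app_nth truthful_bids_def)
    then show ?thesis
      using hpg_assign_SomeD(3)[OF tie finite_buyers that(1)] by (simp add: true_decl_def split: if_splits)
  qed
  then have "satisfied G (outcome (hpg tie (buyers G)) x (truthful_bids G)) i \<longleftrightarrow>
      i \<in> hpg_discarded tie (buyers G) x (truthful_bids G)" for i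
    unfolding satisfied_def outcome_def
    by (subst hpg_discarded_eq[of tie, OF tie finite_buyers]) (auto simp: hpg_def len)
  then show ?thesis by (simp add: SW_def)
qed

text \<open>The dual variables of the primal-dual argument: a buyer served at perturbation \<open>x i\<close> keeps
  \<open>v\<^sub>i exp (x i - 1)\<close> of her value, and the item she receives gets the remainder
  \<open>v\<^sub>i y\<^sub>i\<close>, which is \<^const>\<open>item_dual\<close>.\<close>

definition buyer_dual :: "nat \<Rightarrow> (nat \<Rightarrow> real) \<Rightarrow> real" where
  "buyer_dual i x = val G i * exp (x i - 1) * of_bool (i \<in> greedy nbrs (pval x) (n_items G))"

lemma buyer_dual_nonneg: "i \<in> buyers G \<Longrightarrow> 0 \<le> buyer_dual i x"
  using val_nonneg by (simp add: buyer_dual_def)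

text \<open>For a served buyer the factors \<open>exp (x i - 1)\<close> and \<open>hpg_y x i\<close>
  add up to 1, so both shares together make up her value. The item shares are bounded in total by
  \<open>sum_item_dual_le\<close>.\<close>

lemma duals_le_SW:
  assumes inj: "inj_on (pval x) {k\<in>buyers G. 0 < pval x k}"
  shows "(\<Sum>i\<in>buyers G. buyer_dual i x) + (\<Sum>j<n_items G. item_dual nbrs (pval x) j)
    \<le> SW G (outcome (hpg tie (buyers G)) x (truthful_bids G))"
proof -
  let ?gr = "greedy nbrs (pval x) (n_items G)"
  have sub: "?gr \<subseteq> buyers G" using nbrs_subset by (rule greedy_subset)
  have "take (n_items G) (truthful_bids G) = truthful_bids G" by (simp add: truthful_bids_def)
  then have gr: "?gr \<subseteq> hpg_discarded tie (buyers G) x (truthful_bids G)"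
    using hpg_discarded_positive[OF inj order_refl] by auto
  have "(\<Sum>j<n_items G. item_dual nbrs (pval x) j) \<le> (\<Sum>k\<in>?gr. pval x k)"
    using finite_nbrs by (rule sum_item_dual_le)
  also have "\<dots> = (\<Sum>k\<in>buyers G. pval x k * of_bool (k \<in> ?gr))"
    using sub finite_buyers by (simp add: sum.inter_restrict[symmetric] of_bool_def if_distrib Int_absorb1 cong: if_cong)
  finally have "(\<Sum>i\<in>buyers G. buyer_dual i x) + (\<Sum>j<n_items G. item_dual nbrs (pval x) j) \<le>
      (\<Sum>i\<in>buyers G. buyer_dual i x + pval x i * of_bool (i \<in> ?gr))"
    by (simp add: sum.distrib)
  also have "\<dots> = (\<Sum>i\<in>buyers G. val G i * of_bool (i \<in> ?gr))"
    by (intro sum.cong) (auto simp: buyer_dual_def pval_def hpg_y_def algebra_simps)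
  also have "\<dots> \<le> (\<Sum>i\<in>buyers G. val G i * of_bool (i \<in> hpg_discarded tie (buyers G) x (truthful_bids G)))"
    using gr val_nonneg by (intro sum_mono mult_left_mono) auto
  finally show ?thesis by (simp add: SW_hpg)
qed

lemma AE_inj_pval: "AE x in cube (buyers G). inj_on (pval x) {k\<in>buyers G. 0 < pval x k}"
proof -
  have "AE x in cube (buyers G). \<forall>a\<in>buyers G. \<forall>b\<in>buyers G. a \<noteq> b \<longrightarrow>
      \<not> (val G a * hpg_y x a = val G b * hpg_y x b \<and> 0 < val G b * hpg_y x b)"
    using perturbed_no_ties[OF finite_buyers] finite_buyers by (intro AE_finite_allI) (auto intro!: AE_impI)
  then show ?thesis
    by eventually_elim (auto simp: inj_on_def pval_def)
qed

lemma buyer_dual_integrable: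
  assumes "i \<in> buyers G"
  shows "integrable (cube (buyers G)) (buyer_dual i)"
proof -
  interpret prob_space "cube (buyers G)" by (rule prob_space_cube)
  note [measurable] = measurable_coord_cube[OF assms]
    greedy_measurable[OF finite_buyers nbrs_subset pval_measurable, where k = i and j = "n_items G"]
  show ?thesis
  proof (rule integrable_const_bound)
    show "AE x in cube (buyers G). norm (buyer_dual i x) \<le> val G i"
      using space_cube[OF _ assms] val_nonneg[OF assms]
      by (intro AE_I2) (auto simp: buyer_dual_def abs_mult intro!: mult_left_le)
    show "buyer_dual i \<in> borel_measurable (cube (buyers G))"
      unfolding buyer_dual_def[abs_def] of_bool_def by measurable
  qed
qed

lemma pval_le: "x \<in> space (cube (buyers G)) \<Longrightarrow> k \<in> buyers G \<Longrightarrow> pval x k \<le> val G k"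
  using val_nonneg[of k] by (auto simp: pval_def hpg_y_def intro!: mult_left_le)

lemma item_dual_integrable: "integrable (cube (buyers G)) (\<lambda>x. item_dual nbrs (pval x) j)"
proof -
  interpret prob_space "cube (buyers G)" by (rule prob_space_cube)
  have "item_dual nbrs (pval x) j \<le> (\<Sum>k\<in>buyers G. val G k)" if x: "x \<in> space (cube (buyers G))" for x
  proof (rule item_dual_le[OF finite_nbrs])
    show "0 \<le> (\<Sum>k\<in>buyers G. val G k)" using val_nonneg by (rule sum_nonneg)
    fix k assume "k \<in> nbrs j"
    then have k: "k \<in> buyers G" using nbrs_subset by blast
    have "val G k \<le> (\<Sum>k\<in>buyers G. val G k)"
      using k finite_buyers val_nonneg by (intro member_le_sum) auto
    then show "pval x k \<le> (\<Sum>k\<in>buyers G. val G k)" using pval_le[OF x k] by linarith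
  qed
  then show ?thesis
    using item_dual_nonneg[OF finite_nbrs]
    by (intro integrable_const_bound[where B = "\<Sum>k\<in>buyers G. val G k"]
        item_dual_measurable[OF finite_buyers nbrs_subset pval_measurable]) auto
qed

lemma edge_dual_expectation:
  assumes e: "(i, j) \<in> edges G"
  shows "(1 - exp (-1)) * val G i \<le>
    (\<integral>x. buyer_dual i x + item_dual nbrs (pval x) j \<partial>cube (buyers G))"
proof -
  have i: "i \<in> buyers G" and ij: "i \<in> nbrs j" and j: "Suc j \<le> n_items G"
    using e wf by (auto simp: wf_market_def nbrs_def)
  \<comment> \<open>The weight of \<open>i\<close> is overwritten by 0, so \<open>u\<close> does not
    vary with \<open>x i\<close> and is a constant of the inner integral below.\<close>
  define u where "u = (\<lambda>x. item_dual nbrs ((pval x)(i := 0)) j)"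
  define f where "f = (\<lambda>x. ennreal (val G i * exp (x i - 1) * of_bool (u x < val G i * (1 - exp (x i - 1))) + u x))"
  have u0: "0 \<le> u x" for x using finite_nbrs by (simp add: u_def item_dual_nonneg)
  have u_meas: "u \<in> borel_measurable (cube (buyers G))"
    unfolding u_def using pval_measurable
    by (intro item_dual_measurable[OF finite_buyers nbrs_subset]) (simp add: fun_upd_def)
  have f_meas: "f \<in> borel_measurable (cube (buyers G))"
    unfolding f_def of_bool_def using u_meas measurable_coord_cube[OF i] by measurable
  have "ennreal ((1 - exp (-1)) * val G i) =
      (\<integral>\<^sup>+x. ennreal ((1 - exp (-1)) * val G i) \<partial>cube (buyers G - {i}))"
    using prob_space.emeasure_space_1[OF prob_space_cube] by simp
  also have "\<dots> \<le> (\<integral>\<^sup>+x. (\<integral>\<^sup>+t. f (x(i := t)) \<partial>restrict_space lborel {0..1}) \<partial>cube (buyers G - {i}))"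
  proof (rule nn_integral_mono)
    fix x
    have "(pval (x(i := t)))(i := 0) = (pval x)(i := 0)" for t
      by (auto simp: pval_def hpg_y_def)
    then have "f (x(i := t)) = ennreal (val G i * exp (t - 1) * of_bool (u x < val G i * (1 - exp (t - 1))) + u x)" for t
      by (simp add: f_def u_def)
    then show "ennreal ((1 - exp (-1)) * val G i) \<le> (\<integral>\<^sup>+t. f (x(i := t)) \<partial>restrict_space lborel {0..1})"
      using threshold_integral[OF val_nonneg[OF i] u0[of x]] by simp
  qed
  also have "\<dots> = (\<integral>\<^sup>+x. f x \<partial>cube (buyers G))"
    using nn_integral_cube[OF finite_buyers i f_meas] by simp
  also have "\<dots> \<le> (\<integral>\<^sup>+x. ennreal (buyer_dual i x + item_dual nbrs (pval x) j) \<partial>cube (buyers G))"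
  proof (rule nn_integral_mono)
    fix x
    have "u x \<le> item_dual nbrs (pval x) j"
      unfolding u_def by (rule item_dual_remove_le[OF finite_nbrs])
    moreover have "i \<in> greedy nbrs (pval x) (n_items G)" if "u x < val G i * (1 - exp (x i - 1))"
      using that j ij finite_nbrs
      by (intro greedy_above_threshold[of nbrs j]) (simp_all add: u_def pval_def hpg_y_def)
    ultimately show "f x \<le> ennreal (buyer_dual i x + item_dual nbrs (pval x) j)"
      unfolding f_def using val_nonneg[OF i]
      by (intro ennreal_leI add_mono) (auto simp: buyer_dual_def)
  qed
  also have "\<dots> = ennreal (\<integral>x. buyer_dual i x + item_dual nbrs (pval x) j \<partial>cube (buyers G))"
    using buyer_dual_nonneg[OF i] item_dual_nonneg[OF finite_nbrs]
    by (intro nn_integral_eq_integral Bochner_Integration.integrable_add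
        buyer_dual_integrable[OF i] item_dual_integrable) auto
  finally show ?thesis
    using buyer_dual_nonneg[OF i] item_dual_nonneg[OF finite_nbrs]
    by (subst (asm) ennreal_le_iff) (auto intro!: integral_nonneg_AE)
qed

text \<open>Weak duality: the expected duals of every edge of an optimal matching cover its value up
  to the factor, and each buyer and each item occurs in at most one such edge.\<close>

lemma OPT_le_expected_welfare:
  "(1 - exp (-1)) * OPT G \<le> expected_welfare (hpg tie (buyers G)) G"
proof -
  let ?C = "cube (buyers G)"
  let ?sw = "\<lambda>x. SW G (outcome (hpg tie (buyers G)) x (truthful_bids G))"
  have "OPT G \<in> SW G ` {\<mu>. is_matching G \<mu>}"
    unfolding OPT_def using finite_matchings[OF wf] is_matching_empty by (intro Max_in) auto
  then obtain \<mu> where \<mu>: "is_matching G \<mu>" "OPT G = SW G \<mu>" by auto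
  define P where "P = {i\<in>buyers G. satisfied G \<mu> i}"
  \<comment> \<open>The item of buyer \<open>i\<close> in the optimal matching; injective because an
    item has only one recipient.\<close>
  define f where "f = (\<lambda>i. SOME j. \<mu> j = Some i \<and> (i, j) \<in> edges G)"
  have f: "\<mu> (f i) = Some i \<and> (i, f i) \<in> edges G" if "i \<in> P" for i
    using that unfolding P_def f_def satisfied_def by (auto intro: someI2_ex)
  have inj: "inj_on f P" by (rule inj_onI) (metis f option.inject)
  have fin: "finite P" using finite_buyers by (simp add: P_def)
  have fsub: "f ` P \<subseteq> {..<n_items G}" using f wf by (force simp: wf_market_def)
  have "(1 - exp (-1)) * OPT G = (\<Sum>i\<in>P. (1 - exp (-1)) * val G i)"
    unfolding \<mu>(2) SW_def P_def sum_distrib_left[symmetric] using finite_buyers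
    by (simp add: sum.inter_filter[symmetric] of_bool_def if_distrib cong: if_cong)
  also have "\<dots> \<le> (\<Sum>i\<in>P. (\<integral>x. buyer_dual i x + item_dual nbrs (pval x) (f i) \<partial>?C))"
    using f by (intro sum_mono edge_dual_expectation) auto
  also have "\<dots> = (\<integral>x. (\<Sum>i\<in>P. buyer_dual i x + item_dual nbrs (pval x) (f i)) \<partial>?C)"
    by (intro Bochner_Integration.integral_sum[symmetric] Bochner_Integration.integrable_add
        buyer_dual_integrable item_dual_integrable) (auto simp: P_def)
  also have "\<dots> \<le> (\<integral>x. ?sw x \<partial>?C)"
  proof (rule integral_mono_AE)
    show "integrable ?C (\<lambda>x. \<Sum>i\<in>P. buyer_dual i x + item_dual nbrs (pval x) (f i))"
      by (intro Bochner_Integration.integrable_sum Bochner_Integration.integrable_add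
          buyer_dual_integrable item_dual_integrable) (auto simp: P_def)
    interpret prob_space ?C by (rule prob_space_cube)
    have "(\<lambda>x. of_bool (i \<in> hpg_discarded tie (buyers G) x (truthful_bids G)) :: real) \<in> borel_measurable ?C" for i
      by (rule measurable_compose[OF hpg_discarded_measurable[OF tie finite_buyers]]) auto
    then have "?sw \<in> borel_measurable ?C"
      unfolding SW_hpg by (intro borel_measurable_sum borel_measurable_times borel_measurable_const)
    moreover have "\<bar>?sw x\<bar> \<le> (\<Sum>i\<in>buyers G. val G i)" for x
    proof -
      have "0 \<le> ?sw x" unfolding SW_def using val_nonneg by (intro sum_nonneg) auto
      moreover have "?sw x \<le> (\<Sum>i\<in>buyers G. val G i)"
        unfolding SW_def using val_nonneg by (intro sum_mono) auto
      ultimately show ?thesis by simp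
    qed
    ultimately show "integrable ?C ?sw"
      by (intro integrable_const_bound[where B = "\<Sum>i\<in>buyers G. val G i"]) auto
    show "AE x in ?C. (\<Sum>i\<in>P. buyer_dual i x + item_dual nbrs (pval x) (f i)) \<le> ?sw x"
      using AE_inj_pval
    proof eventually_elim
      case (elim x)
      have "(\<Sum>i\<in>P. buyer_dual i x) \<le> (\<Sum>i\<in>buyers G. buyer_dual i x)"
        using finite_buyers buyer_dual_nonneg by (intro sum_mono2) (auto simp: P_def)
      moreover have "(\<Sum>i\<in>P. item_dual nbrs (pval x) (f i)) = (\<Sum>j\<in>f ` P. item_dual nbrs (pval x) j)"
        using inj by (simp add: sum.reindex)
      moreover have "\<dots> \<le> (\<Sum>j<n_items G. item_dual nbrs (pval x) j)"
        using fsub item_dual_nonneg[OF finite_nbrs] by (intro sum_mono2) auto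
      ultimately show ?case using duals_le_SW[OF elim] by (simp add: sum.distrib)
    qed
  qed
  also have "\<dots> = expected_welfare (hpg tie (buyers G)) G"
    by (simp add: expected_welfare_def rand_hpg)
  finally show ?thesis .
qed

end

lemma hpg_competitive:
  assumes "\<And>S. finite S \<Longrightarrow> S \<noteq> {} \<Longrightarrow> tie S \<in> S"
  shows "competitive (exp 1 / (exp 1 - 1)) (hpg tie)"
  unfolding competitive_def
proof (intro conjI allI impI)
  have e: "1 < exp (1::real)" by simp
  then show "1 \<le> exp 1 / (exp 1 - 1 :: real)" by (simp add: field_simps)
  fix G assume "wf_market G"
  from OPT_le_expected_welfare[OF assms this]
  show "OPT G \<le> exp 1 / (exp 1 - 1) * expected_welfare (hpg tie (buyers G)) G"
    using e by (simp add: exp_minus field_simps)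
qed

section \<open>Tightness\<close>

text \<open>The buyer \<open>\<sigma> k\<close> is interested in the items \<open>0, ..., k\<close>, so that up to item \<open>j\<close> the buyers
  in positions \<open>j, ..., n - 1\<close> cannot be told apart.\<close>

definition triangular_market :: "nat \<Rightarrow> (nat \<Rightarrow> nat) \<Rightarrow> market" where
  "triangular_market n \<sigma> =
     \<lparr> buyers = {..<n}, n_items = n, edges = {(\<sigma> k, j) | k j. j \<le> k \<and> k < n}, val = (\<lambda>_. 1) \<rparr>"

lemma wf_triangular_market:
  assumes "\<sigma> permutes {..<n}"
  shows "wf_market (triangular_market n \<sigma>)"
proof -
  have "\<sigma> k < n" if "k < n" for k using permutes_in_image[OF assms, of k] that by simp
  then show ?thesis by (auto simp: wf_market_def triangular_market_def)
qed

text \<open>The diagonal matching, which gives item \<open>j\<close> to the buyer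
  \<open>\<sigma> j\<close>, serves everybody.\<close>

lemma OPT_triangular_market:
  assumes \<sigma>: "\<sigma> permutes {..<n}"
  shows "real n \<le> OPT (triangular_market n \<sigma>)"
proof -
  let ?G = "triangular_market n \<sigma>"
  let ?\<mu> = "\<lambda>j. if j < n then Some (\<sigma> j) else None"
  have m: "is_matching ?G ?\<mu>"
    using permutes_inj[OF \<sigma>]
    by (auto simp: is_matching_def triangular_market_def inj_def split: if_splits)
  have "satisfied ?G ?\<mu> i" if "i < n" for i
  proof -
    have "i \<in> \<sigma> ` {..<n}" using permutes_image[OF \<sigma>] that by simp
    then obtain k where "k < n" "\<sigma> k = i" by auto
    then show ?thesis
      unfolding satisfied_def triangular_market_def by (intro exI[of _ k]) auto
  qed
  then have "SW ?G ?\<mu> = real n" by (simp add: SW_def triangular_market_def)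
  moreover have "SW ?G ?\<mu> \<le> OPT ?G"
    unfolding OPT_def using m finite_matchings[OF wf_triangular_market[OF \<sigma>]] by (intro Max_ge) auto
  ultimately show ?thesis by simp
qed

text \<open>The guarantees in \<open>online_algorithm\<close> concern valid declarations only; this
  makes them available in every round of a truthful run.\<close>

lemma valid_truthful_prefix:
  assumes "wf_market G"
  shows "valid_bids (buyers G) (take j (truthful_bids G))"
proof -
  have "\<exists>j. b = true_decl G j" if "b \<in> set (take j (truthful_bids G))" for b
    using set_take_subset[of j "truthful_bids G"] that by (auto simp: truthful_bids_def)
  moreover have "valid_bids (buyers G) bs" if bs: "\<forall>b\<in>set bs. \<exists>j. b = true_decl G j" for bs
    unfolding valid_bids_def
  proof (intro conjI ballI allI impI)
    fix b i assume "b \<in> set bs"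
    with bs obtain j where b: "b = true_decl G j" by blast
    show "b i = None" if "i \<notin> buyers G"
      using that assms by (auto simp: b true_decl_def wf_market_def)
    show "0 \<le> bid b i"
      using assms by (auto simp: b true_decl_def wf_market_def bid_def)
  next
    fix i b b' assume b: "b \<in> set bs" "b' \<in> set bs" "bid b i \<noteq> 0 \<and> bid b' i \<noteq> 0"
    then obtain j j' where "b = true_decl G j" "b' = true_decl G j'"
      using bs by blast
    with b(3) show "bid b i = bid b' i" by (auto simp: true_decl_def bid_def split: if_splits)
  qed
  ultimately show ?thesis by blast
qed

lemma expected_welfare_integrable:
  assumes A: "online_algorithm (buyers G) A" and wf: "wf_market G"
  shows "integrable (rand A) (\<lambda>\<omega>. SW G (outcome A \<omega> (truthful_bids G)))"
proof -
  interpret prob_space "rand A" using A by (simp add: online_algorithm_def)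
  have len: "length (truthful_bids G) = n_items G" by (simp add: truthful_bids_def)
  have "(\<lambda>\<omega>. assign A \<omega> (take (Suc j) (truthful_bids G))) \<in> measurable (rand A) (count_space UNIV)"
    if "j < n_items G" for j
  proof -
    have "take (Suc j) (truthful_bids G) \<noteq> []" using that len by auto
    then show ?thesis
      using A valid_truthful_prefix[OF wf] unfolding online_algorithm_def by blast
  qed
  then have *: "Measurable.pred (rand A) (\<lambda>\<omega>. assign A \<omega> (take (Suc j) (truthful_bids G)) = Some i)"
    if "j < n_items G" for i j
    using that by (intro pred_eq_const1) auto
  have "satisfied G (outcome A \<omega> (truthful_bids G)) i \<longleftrightarrow>
      (\<exists>j\<in>{..<n_items G}. assign A \<omega> (take (Suc j) (truthful_bids G)) = Some i \<and> (i, j) \<in> edges G)" for \<omega> i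
    by (auto simp: satisfied_def outcome_def len)
  then have "Measurable.pred (rand A) (\<lambda>\<omega>. satisfied G (outcome A \<omega> (truthful_bids G)) i)" for i
    using * by (simp only:) (intro pred_intros_finite pred_intros_logic, auto)
  then have "(\<lambda>\<omega>. SW G (outcome A \<omega> (truthful_bids G))) \<in> borel_measurable (rand A)"
    unfolding SW_def of_bool_def
    by (intro borel_measurable_sum borel_measurable_times borel_measurable_const measurable_If) (auto simp: pred_def)
  moreover have "\<bar>SW G (outcome A \<omega> (truthful_bids G))\<bar> \<le> (\<Sum>i\<in>buyers G. \<bar>val G i\<bar>)" for \<omega>
    unfolding SW_def by (rule order_trans[OF sum_abs]) (auto intro!: sum_mono simp: abs_mult)
  ultimately show ?thesis
    by (intro integrable_const_bound[where B = "\<Sum>i\<in>buyers G. \<bar>val G i\<bar>"]) auto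
qed

lemma online_outcome_truthful:
  assumes A: "online_algorithm (buyers G) A" and wf: "wf_market G" and \<omega>: "\<omega> \<in> space (rand A)"
    and i: "outcome A \<omega> (truthful_bids G) j = Some i"
  shows "(i, j) \<in> edges G" "j < n_items G"
    and "k < j \<Longrightarrow> outcome A \<omega> (truthful_bids G) k \<noteq> Some i"
proof -
  let ?bs = "take (Suc j) (truthful_bids G)"
  have len: "length (truthful_bids G) = n_items G" by (simp add: truthful_bids_def)
  show j: "j < n_items G" using i by (simp add: outcome_def len split: if_splits)
  then have a: "assign A \<omega> ?bs = Some i" using i by (simp add: outcome_def len)
  have "?bs \<noteq> []" using j len by auto
  then have *: "last ?bs i \<noteq> None" "\<forall>k<length ?bs - 1. outcome A \<omega> ?bs k \<noteq> Some i"
    using A valid_truthful_prefix[OF wf] \<omega> a unfolding online_algorithm_def by blast+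
  have "last ?bs = true_decl G j"
    using j by (simp add: take_Suc_conv_app_nth truthful_bids_def)
  with * show "(i, j) \<in> edges G" by (simp add: true_decl_def split: if_splits)
  assume k: "k < j"
  then have "outcome A \<omega> ?bs k = outcome A \<omega> (truthful_bids G) k"
    using j by (simp add: outcome_def len min_def)
  with *(2) k j show "outcome A \<omega> (truthful_bids G) k \<noteq> Some i" by (auto simp: len)
qed

section \<open>Averaging over relabellings of the triangular market\<close>

lemma triangular_decl_transpose:
  assumes "j \<le> k" "k < n" "l \<le> j"
  shows "true_decl (triangular_market n (\<sigma> \<circ> Transposition.transpose k (n - 1))) l = true_decl (triangular_market n \<sigma>) l"
proof -
  \<comment> \<open>Both swapped positions are at least \<open>l\<close>, so the swap preserves the
    set of positions interested in item \<open>l\<close>.\<close>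
  have t: "Transposition.transpose k (n - 1) ` {l..<n} = {l..<n}"
    using assms by (intro permutes_image permutes_swap_id) auto
  have E: "(i, l) \<in> edges (triangular_market n \<sigma>) \<longleftrightarrow> i \<in> \<sigma> ` {l..<n}" for i \<sigma>
    by (auto simp: triangular_market_def)
  have "i \<in> (\<sigma> \<circ> Transposition.transpose k (n - 1)) ` {l..<n} \<longleftrightarrow> i \<in> \<sigma> ` {l..<n}" for i
    by (simp only: image_comp[symmetric] t)
  moreover have "val (triangular_market n \<sigma>') = (\<lambda>_. 1)" for \<sigma>'
    by (simp add: triangular_market_def)
  ultimately show ?thesis unfolding true_decl_def E by presburger
qed

lemma triangular_outcome_transpose:
  assumes "j \<le> k" "k < n"
  shows "outcome A \<omega> (truthful_bids (triangular_market n (\<sigma> \<circ> Transposition.transpose k (n - 1)))) j =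
    outcome A \<omega> (truthful_bids (triangular_market n \<sigma>)) j"
proof -
  have "take (Suc j) (truthful_bids (triangular_market n (\<sigma> \<circ> Transposition.transpose k (n - 1)))) =
      take (Suc j) (truthful_bids (triangular_market n \<sigma>))"
    using assms triangular_decl_transpose[of j k n _ \<sigma>]
    by (intro nth_equalityI) (auto simp: truthful_bids_def triangular_market_def)
  then show ?thesis by (simp add: outcome_def truthful_bids_def triangular_market_def)
qed

text \<open>Summing over all relabellings for a fixed realization plays the part of Yao's principle.
  Here \<open>a j\<close> counts the relabellings under which item \<open>j\<close> is assigned and
  \<open>L j\<close> those under which it goes to the last position. With \<open>aL\<close>, the
  bounds \<open>a j \<le> fact n\<close> and \<open>Lsum\<close> form a linear program, for which
  every \<open>c \<ge> 0\<close> yields a dual bound.\<close>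

lemma sum_triangular_welfare_le:
  fixes n :: nat and c :: real
  assumes A: "online_algorithm {..<n} A" and \<omega>: "\<omega> \<in> space (rand A)" and c: "0 \<le> c"
  shows "(\<Sum>\<sigma> | \<sigma> permutes {..<n}. SW (triangular_market n \<sigma>)
      (outcome A \<omega> (truthful_bids (triangular_market n \<sigma>))))
    \<le> fact n * (c + (\<Sum>r=1..n. max 0 (1 - c / real r)))"
proof -
  define S where "S = {\<sigma>. \<sigma> permutes {..<n}}"
  define g where "g = (\<lambda>\<sigma> j. outcome A \<omega> (truthful_bids (triangular_market n \<sigma>)) j)"
  define a where "a = (\<lambda>j. \<Sum>\<sigma>\<in>S. of_bool (g \<sigma> j \<noteq> None) :: real)"
  define L where "L = (\<lambda>j. \<Sum>\<sigma>\<in>S. of_bool (g \<sigma> j = Some (\<sigma> (n - 1))) :: real)"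
  have finS: "finite S" and cardS: "card S = fact n"
    by (simp_all add: S_def finite_permutations card_permutations)
  have bn: "buyers (triangular_market n \<sigma>) = {..<n}" "n_items (triangular_market n \<sigma>) = n" for \<sigma>
    by (simp_all add: triangular_market_def)
  have g: "(i, j) \<in> edges (triangular_market n \<sigma>)" "j < n" "\<And>k. k < j \<Longrightarrow> g \<sigma> k \<noteq> Some i"
    if "g \<sigma> j = Some i" "\<sigma> \<in> S" for \<sigma> i j
  proof -
    have "wf_market (triangular_market n \<sigma>)" "online_algorithm (buyers (triangular_market n \<sigma>)) A"
      using that A wf_triangular_market by (simp_all add: S_def bn)
    note * = online_outcome_truthful[OF this(2,1) \<omega> that(1)[unfolded g_def]]
    show "(i, j) \<in> edges (triangular_market n \<sigma>)" by (rule *(1))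
    show "j < n" using *(2) by (simp add: bn)
    show "\<And>k. k < j \<Longrightarrow> g \<sigma> k \<noteq> Some i" unfolding g_def by (rule *(3))
  qed
  have g_inj: "j = k" if "g \<sigma> j = Some i" "g \<sigma> k = Some i" "\<sigma> \<in> S" for \<sigma> i j k
    using g(3) that by (metis linorder_neqE_nat)
  have SW_le: "SW (triangular_market n \<sigma>) (outcome A \<omega> (truthful_bids (triangular_market n \<sigma>))) \<le>
      (\<Sum>j<n. of_bool (g \<sigma> j \<noteq> None))" if "\<sigma> \<in> S" for \<sigma>
  proof -
    let ?G = "triangular_market n \<sigma>"
    have "SW ?G (g \<sigma>) = real (card {i\<in>{..<n}. satisfied ?G (g \<sigma>) i})"
      by (simp add: SW_def bn) (simp add: triangular_market_def Collect_conj_eq lessThan_def)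
    also have "\<dots> \<le> real (card {j\<in>{..<n}. g \<sigma> j \<noteq> None})"
    proof (intro of_nat_mono surj_card_le)
      show "{i\<in>{..<n}. satisfied ?G (g \<sigma>) i} \<subseteq> (\<lambda>j. the (g \<sigma> j)) ` {j\<in>{..<n}. g \<sigma> j \<noteq> None}"
      proof
        fix i assume "i \<in> {i\<in>{..<n}. satisfied ?G (g \<sigma>) i}"
        then obtain j where j: "g \<sigma> j = Some i" by (auto simp: satisfied_def)
        then show "i \<in> (\<lambda>j. the (g \<sigma> j)) ` {j\<in>{..<n}. g \<sigma> j \<noteq> None}"
          using g(2)[OF j that] by (intro image_eqI[of _ _ j]) auto
      qed
    qed simp
    also have "\<dots> = (\<Sum>j<n. of_bool (g \<sigma> j \<noteq> None))"
      by (simp add: Collect_conj_eq lessThan_def)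
    finally show ?thesis unfolding g_def .
  qed
  \<comment> \<open>Composition with the swap of positions \<open>k\<close> and \<open>n - 1\<close>
    is an involution on the relabellings. It leaves the decision on item \<open>j\<close> unchanged
    and exchanges the buyers in these positions.\<close>
  have sym: "(\<Sum>\<sigma>\<in>S. of_bool (g \<sigma> j = Some (\<sigma> k))) = L j" if "j \<le> k" "k < n" for j k
  proof -
    let ?t = "Transposition.transpose k (n - 1)"
    have t: "?t permutes {..<n}" using that by (intro permutes_swap_id) auto
    have "bij_betw (\<lambda>\<sigma>. \<sigma> \<circ> ?t) S S"
      using t by (intro bij_betwI[where g = "\<lambda>\<sigma>. \<sigma> \<circ> ?t"])
        (simp_all add: S_def permutes_compose comp_assoc)
    then have "L j = (\<Sum>\<sigma>\<in>S. of_bool (g (\<sigma> \<circ> ?t) j = Some ((\<sigma> \<circ> ?t) (n - 1))))"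
      unfolding L_def by (rule sum.reindex_bij_betw[symmetric])
    also have "\<dots> = (\<Sum>\<sigma>\<in>S. of_bool (g \<sigma> j = Some (\<sigma> k)))"
      unfolding g_def triangular_outcome_transpose[OF that] by (simp only: comp_apply transpose_apply_second)
    finally show ?thesis ..
  qed
  \<comment> \<open>If item \<open>j\<close> is assigned, it goes to the last position in one out of \<open>n - j\<close> cases.\<close>
  have aL: "a j = real (n - j) * L j" if "j < n" for j
  proof -
    have "(of_bool (g \<sigma> j \<noteq> None) :: real) = (\<Sum>k\<in>{j..<n}. of_bool (g \<sigma> j = Some (\<sigma> k)))"
      if \<sigma>: "\<sigma> \<in> S" for \<sigma>
    proof (cases "g \<sigma> j")
      case (Some i)
      then obtain m where m: "m \<in> {j..<n}" "i = \<sigma> m"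
        using g(1)[OF Some \<sigma>] by (auto simp: triangular_market_def)
      have "\<sigma> m = \<sigma> k \<longleftrightarrow> k = m" for k
        using permutes_inj \<sigma> by (auto simp: S_def inj_def)
      then show ?thesis using m Some by (simp add: of_bool_def)
    qed simp
    then have "a j = (\<Sum>\<sigma>\<in>S. \<Sum>k\<in>{j..<n}. of_bool (g \<sigma> j = Some (\<sigma> k)))"
      unfolding a_def by (intro sum.cong) auto
    also have "\<dots> = (\<Sum>k\<in>{j..<n}. \<Sum>\<sigma>\<in>S. of_bool (g \<sigma> j = Some (\<sigma> k)))" by (rule sum.swap)
    also have "\<dots> = (\<Sum>k\<in>{j..<n}. L j)" by (intro sum.cong) (auto simp: sym)
    finally show ?thesis by simp
  qed
  \<comment> \<open>Under each relabelling the buyer in the last position receives at most one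
    item.\<close>
  have Lsum: "(\<Sum>j<n. L j) \<le> fact n"
  proof -
    have "(\<Sum>j<n. of_bool (g \<sigma> j = Some (\<sigma> (n - 1)))) \<le> (1::real)" if "\<sigma> \<in> S" for \<sigma>
    proof -
      have "card {j\<in>{..<n}. g \<sigma> j = Some (\<sigma> (n - 1))} \<le> 1"
        unfolding One_nat_def by (rule card_le_Suc0_iff_eq[THEN iffD2]) (auto intro: g_inj[OF _ _ that])
      then show ?thesis by (simp add: Collect_conj_eq lessThan_def)
    qed
    then have "(\<Sum>\<sigma>\<in>S. \<Sum>j<n. of_bool (g \<sigma> j = Some (\<sigma> (n - 1)))) \<le> (\<Sum>\<sigma>\<in>S. (1::real))"
      by (rule sum_mono)
    then show ?thesis unfolding L_def by (subst sum.swap) (simp add: cardS)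
  qed
  have "a j \<le> fact n * max 0 (1 - c / real (n - j)) + c * L j" if "j < n" for j
  proof -
    have "a j \<le> (\<Sum>\<sigma>\<in>S. 1)" unfolding a_def by (intro sum_mono) auto
    then have a1: "a j \<le> fact n" by (simp add: cardS)
    have a0: "0 \<le> a j" unfolding a_def by (intro sum_nonneg) auto
    \<comment> \<open>Weak LP duality, with multiplier \<open>c\<close> for the constraint \<open>Lsum\<close>.\<close>
    have "L j = a j / real (n - j)" using aL[OF that] that by simp
    then have "a j = a j * (1 - c / real (n - j)) + c * L j" by (simp add: right_diff_distrib)
    moreover have "a j * (1 - c / real (n - j)) \<le> a j * max 0 (1 - c / real (n - j))"
      using a0 by (intro mult_left_mono) auto
    moreover have "a j * max 0 (1 - c / real (n - j)) \<le> fact n * max 0 (1 - c / real (n - j))"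
      using a1 by (intro mult_right_mono) auto
    ultimately show ?thesis by linarith
  qed
  then have "(\<Sum>j<n. a j) \<le> (\<Sum>j<n. fact n * max 0 (1 - c / real (n - j)) + c * L j)"
    by (intro sum_mono) auto
  also have "\<dots> = fact n * (\<Sum>j<n. max 0 (1 - c / real (n - j))) + c * (\<Sum>j<n. L j)"
    by (simp add: sum.distrib sum_distrib_left)
  \<comment> \<open>The new index \<open>r = n - j\<close> is the number of buyers interested in
    item \<open>j\<close>.\<close>
  also have "(\<Sum>j<n. max 0 (1 - c / real (n - j))) = (\<Sum>r=1..n. max 0 (1 - c / real r))"
    by (rule sum.reindex_bij_witness[where i = "\<lambda>r. n - r" and j = "\<lambda>j. n - j"]) auto
  also have "c * (\<Sum>j<n. L j) \<le> c * fact n" using Lsum c by (rule mult_left_mono)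
  finally have "(\<Sum>j<n. a j) \<le> fact n * (c + (\<Sum>r=1..n. max 0 (1 - c / real r)))"
    by (simp add: algebra_simps)
  moreover have "(\<Sum>\<sigma>\<in>S. SW (triangular_market n \<sigma>) (outcome A \<omega> (truthful_bids (triangular_market n \<sigma>))))
      \<le> (\<Sum>\<sigma>\<in>S. \<Sum>j<n. of_bool (g \<sigma> j \<noteq> None))"
    by (intro sum_mono SW_le)
  moreover have "\<dots> = (\<Sum>j<n. a j)" unfolding a_def by (rule sum.swap)
  ultimately show ?thesis unfolding S_def by simp
qed

text \<open>The guarantee holds for each relabelling, hence for their sum. Exchanging sum and
  expectation makes the bound for single realizations applicable, and \<open>fact n\<close>
  cancels.\<close>

lemma competitive_imp_dual_bound:
  assumes F: "\<And>B. finite B \<Longrightarrow> online_algorithm B (F B)" and comp: "competitive \<alpha> F" and c: "0 \<le> c"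
  shows "real n \<le> \<alpha> * (c + (\<Sum>r=1..n. max 0 (1 - c / real r)))"
proof -
  let ?S = "{\<sigma>. \<sigma> permutes {..<n}}"
  let ?A = "F {..<n}"
  let ?K = "c + (\<Sum>r=1..n. max 0 (1 - c / real r))"
  let ?sw = "\<lambda>\<sigma> \<omega>. SW (triangular_market n \<sigma>) (outcome ?A \<omega> (truthful_bids (triangular_market n \<sigma>)))"
  have A: "online_algorithm {..<n} ?A" by (rule F) simp
  then interpret prob_space "rand ?A" by (simp add: online_algorithm_def)
  have bn: "buyers (triangular_market n \<sigma>) = {..<n}" for \<sigma> by (simp add: triangular_market_def)
  have \<alpha>: "1 \<le> \<alpha>" using comp by (simp add: competitive_def)
  have int: "integrable (rand ?A) (?sw \<sigma>)" if "\<sigma> \<in> ?S" for \<sigma>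
    using that A by (intro expected_welfare_integrable wf_triangular_market) (auto simp: bn)
  have "real n \<le> \<alpha> * (\<integral>\<omega>. ?sw \<sigma> \<omega> \<partial>rand ?A)" if "\<sigma> \<in> ?S" for \<sigma>
  proof -
    have "real n \<le> OPT (triangular_market n \<sigma>)" using that OPT_triangular_market by blast
    also have "\<dots> \<le> \<alpha> * expected_welfare (F (buyers (triangular_market n \<sigma>))) (triangular_market n \<sigma>)"
      using comp that wf_triangular_market unfolding competitive_def by blast
    finally show ?thesis by (simp add: bn expected_welfare_def)
  qed
  then have "(\<Sum>\<sigma>\<in>?S. real n) \<le> (\<Sum>\<sigma>\<in>?S. \<alpha> * (\<integral>\<omega>. ?sw \<sigma> \<omega> \<partial>rand ?A))" by (rule sum_mono)
  also have "\<dots> = \<alpha> * (\<integral>\<omega>. (\<Sum>\<sigma>\<in>?S. ?sw \<sigma> \<omega>) \<partial>rand ?A)"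
    using int by (simp add: sum_distrib_left[symmetric] Bochner_Integration.integral_sum)
  also have "\<dots> \<le> \<alpha> * (fact n * ?K)"
  proof (rule mult_left_mono)
    have "(\<integral>\<omega>. (\<Sum>\<sigma>\<in>?S. ?sw \<sigma> \<omega>) \<partial>rand ?A) \<le> (\<integral>\<omega>. fact n * ?K \<partial>rand ?A)"
      using int sum_triangular_welfare_le[OF A _ c]
      by (intro integral_mono Bochner_Integration.integrable_sum) auto
    then show "(\<integral>\<omega>. (\<Sum>\<sigma>\<in>?S. ?sw \<sigma> \<omega>) \<partial>rand ?A) \<le> fact n * ?K"
      by (simp add: prob_space)
  qed (use \<alpha> in simp)
  finally have "fact n * real n \<le> fact n * (\<alpha> * ?K)"
    by (simp add: card_permutations mult_ac)
  then show ?thesis by (simp add: mult_le_cancel_left_pos)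
qed

section \<open>Asymptotics of the dual bound\<close>

lemma ln_le_sum_inverse:
  "m \<le> n \<Longrightarrow> ln (real (n + 1) / real (m + 1)) \<le> (\<Sum>r=m+1..n. 1 / real r)"
proof (induction n rule: dec_induct)
  case (step n)
  \<comment> \<open>The shift by one makes the increment of the logarithm equal to
    \<open>ln (1 + 1 / real (n + 1))\<close>, which is at most the new summand.\<close>
  have "real (Suc n + 1) / real (m + 1) = real (n + 1) / real (m + 1) * (1 + 1 / real (n + 1))"
    by (simp add: divide_simps)
  moreover have "0 < real (n + 1) / real (m + 1)" "0 < 1 + 1 / real (n + 1)"
    by (simp_all add: add_pos_nonneg)
  ultimately have "ln (real (Suc n + 1) / real (m + 1)) =
      ln (real (n + 1) / real (m + 1)) + ln (1 + 1 / real (n + 1))"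
    by (metis ln_mult_pos)
  also have "ln (1 + 1 / real (n + 1)) \<le> 1 / real (n + 1)" by (rule ln_add_one_self_le_self) simp
  finally show ?case using step by simp
qed simp

text \<open>For an integral multiplier \<open>m\<close> the terms with \<open>r \<le> m\<close>
  vanish and the remaining ones form a harmonic sum.\<close>

lemma dual_bound_le:
  assumes "m \<le> n"
  shows "real m + (\<Sum>r=1..n. max 0 (1 - real m / real r)) \<le>
    real n - real m * ln (real (n + 1) / real (m + 1))"
proof -
  have "(\<Sum>r=1..n. max 0 (1 - real m / real r)) = (\<Sum>r=m+1..n. 1 - real m / real r)"
    using assms by (intro sum.mono_neutral_cong_right) (auto simp: max_def field_simps)
  also have "\<dots> = real n - real m - real m * (\<Sum>r=m+1..n. 1 / real r)"
    using assms by (simp add: sum_subtractf sum_distrib_left)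
  finally show ?thesis
    using mult_left_mono[OF ln_le_sum_inverse[OF assms], of "real m"] by simp
qed

text \<open>After division by \<open>n\<close>, the ratio \<open>m n / n\<close> tends to
  \<open>1 / exp 1\<close> and the logarithm to 1, so the dual bound tends to
  \<open>1 - 1 / exp 1\<close> and forces \<open>\<alpha>\<close> to be at least its
  reciprocal.\<close>

lemma not_competitive_below:
  assumes F: "\<And>B. finite B \<Longrightarrow> online_algorithm B (F B)" and \<alpha>: "\<alpha> < exp 1 / (exp 1 - 1)"
  shows "\<not> competitive \<alpha> F"
proof
  assume comp: "competitive \<alpha> F"
  \<comment> \<open>\<open>n / e\<close> is the asymptotically optimal multiplier.\<close>
  define m where "m = (\<lambda>n. nat \<lfloor>real n / exp 1\<rfloor>)"
  have mn: "m n \<le> n" for n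
  proof -
    have "real n / exp 1 \<le> real n" by (simp add: divide_le_eq mult_le_cancel_left1)
    then show ?thesis unfolding m_def by linarith
  qed
  have rm: "real (m n) = of_int \<lfloor>real n / exp 1\<rfloor>" for n by (simp add: m_def)
  have "(\<lambda>n. 1 - real (m n) / real n * ln (real (n + 1) / real (m n + 1))) \<longlonglongrightarrow> 1 - 1 / exp 1"
    unfolding of_nat_add of_nat_1 rm by (simp only: inverse_eq_divide[symmetric]) real_asymp
  then have lim: "(\<lambda>n. \<alpha> * (1 - real (m n) / real n * ln (real (n + 1) / real (m n + 1)))) \<longlonglongrightarrow>
      \<alpha> * (1 - 1 / exp 1)"
    by (rule tendsto_mult_left)
  have "1 \<le> \<alpha> * (1 - real (m n) / real n * ln (real (n + 1) / real (m n + 1)))" if "1 \<le> n" for n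
  proof -
    have "0 \<le> \<alpha>" using comp by (simp add: competitive_def)
    then have "real n \<le> \<alpha> * (real n - real (m n) * ln (real (n + 1) / real (m n + 1)))"
      using competitive_imp_dual_bound[OF F comp, of "real (m n)" n] dual_bound_le[OF mn]
      by (meson mult_left_mono of_nat_0_le_iff order_trans)
    then show ?thesis using that by (simp add: field_simps)
  qed
  then have "1 \<le> \<alpha> * (1 - 1 / exp 1)" using lim by (intro LIMSEQ_le_const) auto
  moreover have "1 < exp (1::real)" by simp
  ultimately show False using \<alpha> by (simp add: field_simps)
qed

theorem theorem2:
  fixes tie :: "nat set \<Rightarrow> nat"
  assumes tie: "\<And>S. finite S \<Longrightarrow> S \<noteq> {} \<Longrightarrow> tie S \<in> S"
  shows "(\<forall>B. finite B \<longrightarrow>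
            online_mechanism B (hpg tie B) \<and> prompt B (hpg tie B) \<and>
            ex_post_IR B (hpg tie B) \<and> truthful_myopic B (hpg tie B))
       \<and> competitive (exp 1 / (exp 1 - 1)) (hpg tie)
       \<and> (\<forall>(F :: nat set \<Rightarrow> 'w algorithm) \<alpha>.
            (\<forall>B. finite B \<longrightarrow> online_algorithm B (F B)) \<and> \<alpha> < exp 1 / (exp 1 - 1)
            \<longrightarrow> \<not> competitive \<alpha> F)"
proof (intro conjI allI impI; (elim conjE)?)
  fix B :: "nat set"
  assume "finite B"
  then show "online_mechanism B (hpg tie B)" "prompt B (hpg tie B)" "ex_post_IR B (hpg tie B)"
    "truthful_myopic B (hpg tie B)"
    using tie by (simp_all add: online_mechanism_hpg prompt_hpg ex_post_IR_hpg truthful_myopic_hpg)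
next
  show "competitive (exp 1 / (exp 1 - 1)) (hpg tie)" using tie by (rule hpg_competitive)
next
  fix F :: "nat set \<Rightarrow> 'w algorithm" and \<alpha> :: real
  assume "\<forall>B. finite B \<longrightarrow> online_algorithm B (F B)" "\<alpha> < exp 1 / (exp 1 - 1)"
  then show "\<not> competitive \<alpha> F" using not_competitive_below by blast
qed

end
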